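(* Let $(I,\alpha)$ be a unit object in a semi-monoidal 2-category $\mathcal{C}$, with a chosen left constraint $(\lambda,L)$ and right constraint $(\rho,R)$. Let $K_{X,Y}:X\lambda_Y\Rightarrow\rho_XY$, $K^\lambda_{X,Y}:\lambda_{XY}\Rightarrow\lambda_XY$ and $K^\rho_{X,Y}:X\rho_Y\Rightarrow\rho_{XY}$ be the invertible 2-cells uniquely determined by the equations $$(R_XY\#X\lambda_Y)\bullet(XL_Y\#\rho_XY)=X\alpha Y\#K_{X,Y},$$ $$IK^\lambda_{X,Y}=L_{XY}\bullet(L_X^{-1}Y),\qquad K^\rho_{X,Y}I=(XR_Y^{-1})\bullet R_{XY}.$$ Then for all objects $X,Y,Z$: $$(XK^\lambda_{Y,Z})\bullet(K_{X,Y}Z)=K_{X,YZ}\quad\text{as 2-cells } X\lambda_{YZ}\Rightarrow\rho_XYZ,$$ $$(XK_{Y,Z})\bullet(K^\rho_{X,Y}Z)=K_{XY,Z}\quad\text{as 2-cells } XY\lambda_Z\Rightarrow\rho_{XY}Z.$$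
   Context: A semi-monoidal 2-category $\mathcal{C}$ is a strict 2-category with a strict 2-functor $\mathcal{C}\times\mathcal{C}\to\mathcal{C}$, $(X,Y)\mapsto XY$ (tensor product, written by juxtaposition), strictly associative. No unit is assumed. $\#$ denotes composition of arrows and horizontal composition of 2-cells (including whiskering), written left to right; $\bullet$ denotes vertical composition of 2-cells, also left to right. The name of an object (arrow) also denotes its identity arrow (identity 2-cell). An equi-arrow is an arrow admitting a pseudo-inverse. An object $I$ is cancellable if $X\mapsto IX$ and $X\mapsto XI$ are fully faithful 2-functors, i.e. induce equivalences on hom categories. A unit object is a pair $(I,\alpha)$ with $I$ cancellable and $\alpha: II\to I$ an equi-arrow. A left constraint consists, for each object $X$, of an equi-arrow $\lambda_X:IX\to X$ and an invertible 2-cell $L_X:I\lambda_X\Rightarrow\alpha X$; a right constraint consists, for each $X$, of an equi-arrow $\rho_X:XI\to X$ and an invertible 2-cell $R_X:X\alpha\Rightarrow\rho_XI$. (The $\lambda_X$ and $\rho_X$ carry unique pseudo-natural structures making $L$ and $R$ modifications.) The left-hand side of the equation defining $K$ is the composite $X\alpha Y\#X\lambda_Y\Rightarrow\rho_XIY\#X\lambda_Y=XI\lambda_Y\#\rho_XY\Rightarrow X\alpha Y\#\rho_XY$; $K_{X,Y}$ is determined since $X\alpha Y$ is an equi-arrow, and $K^\lambda$, $K^\rho$ are determined since $I$ is cancellable. *)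

theory Defs
  imports Main
begin

section \<open>Categories\<close>

text \<open>Composition in any category is written in diagrammatic (left to right) order. Operations
  are only constrained on composable elements of the carriers.\<close>

record ('o, 'm) category_data =
  Ob :: "'o set"
  Mor :: "'m set"
  Dom :: "'m \<Rightarrow> 'o"
  Cod :: "'m \<Rightarrow> 'o"
  Ident :: "'o \<Rightarrow> 'm"
  Comp :: "'m \<Rightarrow> 'm \<Rightarrow> 'm"

locale category =
  fixes A :: "('o, 'm) category_data"
  assumes Dom_closed: "f \<in> Mor A \<Longrightarrow> Dom A f \<in> Ob A"
    and Cod_closed: "f \<in> Mor A \<Longrightarrow> Cod A f \<in> Ob A"
    and Ident_closed: "x \<in> Ob A \<Longrightarrow> Ident A x \<in> Mor A"
    and Dom_Ident: "x \<in> Ob A \<Longrightarrow> Dom A (Ident A x) = x"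
    and Cod_Ident: "x \<in> Ob A \<Longrightarrow> Cod A (Ident A x) = x"
    and Comp_closed: "\<lbrakk>f \<in> Mor A; g \<in> Mor A; Cod A f = Dom A g\<rbrakk> \<Longrightarrow> Comp A f g \<in> Mor A"
    and Dom_Comp: "\<lbrakk>f \<in> Mor A; g \<in> Mor A; Cod A f = Dom A g\<rbrakk> \<Longrightarrow> Dom A (Comp A f g) = Dom A f"
    and Cod_Comp: "\<lbrakk>f \<in> Mor A; g \<in> Mor A; Cod A f = Dom A g\<rbrakk> \<Longrightarrow> Cod A (Comp A f g) = Cod A g"
    and Ident_left: "f \<in> Mor A \<Longrightarrow> Comp A (Ident A (Dom A f)) f = f"
    and Ident_right: "f \<in> Mor A \<Longrightarrow> Comp A f (Ident A (Cod A f)) = f"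
    and Comp_assoc: "\<lbrakk>f \<in> Mor A; g \<in> Mor A; h \<in> Mor A; Cod A f = Dom A g; Cod A g = Dom A h\<rbrakk>
      \<Longrightarrow> Comp A (Comp A f g) h = Comp A f (Comp A g h)"

definition inverse_pair :: "('o, 'm) category_data \<Rightarrow> 'm \<Rightarrow> 'm \<Rightarrow> bool" where
  "inverse_pair A f g \<longleftrightarrow>
     f \<in> Mor A \<and> g \<in> Mor A \<and> Cod A f = Dom A g \<and> Cod A g = Dom A f \<and>
     Comp A f g = Ident A (Dom A f) \<and> Comp A g f = Ident A (Dom A g)"

definition isomorphism :: "('o, 'm) category_data \<Rightarrow> 'm \<Rightarrow> bool" where
  "isomorphism A f \<longleftrightarrow> (\<exists>g. inverse_pair A f g)"

locale category_functor = A: category A + B: category B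
  for A :: "('o, 'm) category_data" and B :: "('p, 'n) category_data" +
  fixes F0 :: "'o \<Rightarrow> 'p" and F1 :: "'m \<Rightarrow> 'n"
  assumes F0_closed: "x \<in> Ob A \<Longrightarrow> F0 x \<in> Ob B"
    and F1_closed: "f \<in> Mor A \<Longrightarrow> F1 f \<in> Mor B"
    and F1_Dom: "f \<in> Mor A \<Longrightarrow> Dom B (F1 f) = F0 (Dom A f)"
    and F1_Cod: "f \<in> Mor A \<Longrightarrow> Cod B (F1 f) = F0 (Cod A f)"
    and F1_Ident: "x \<in> Ob A \<Longrightarrow> F1 (Ident A x) = Ident B (F0 x)"
    and F1_Comp: "\<lbrakk>f \<in> Mor A; g \<in> Mor A; Cod A f = Dom A g\<rbrakk>
      \<Longrightarrow> F1 (Comp A f g) = Comp B (F1 f) (F1 g)"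

definition natural_isomorphism ::
  "('o, 'm) category_data \<Rightarrow> ('p, 'n) category_data \<Rightarrow>
   ('o \<Rightarrow> 'p) \<Rightarrow> ('m \<Rightarrow> 'n) \<Rightarrow> ('o \<Rightarrow> 'p) \<Rightarrow> ('m \<Rightarrow> 'n) \<Rightarrow> ('o \<Rightarrow> 'n) \<Rightarrow> bool" where
  "natural_isomorphism A B F0 F1 G0 G1 \<eta> \<longleftrightarrow>
     (\<forall>x\<in>Ob A. isomorphism B (\<eta> x) \<and> Dom B (\<eta> x) = F0 x \<and> Cod B (\<eta> x) = G0 x) \<and>
     (\<forall>f\<in>Mor A. Comp B (F1 f) (\<eta> (Cod A f)) = Comp B (\<eta> (Dom A f)) (G1 f))"

definition equivalence_functor ::
  "('o, 'm) category_data \<Rightarrow> ('p, 'n) category_data \<Rightarrow> ('o \<Rightarrow> 'p) \<Rightarrow> ('m \<Rightarrow> 'n) \<Rightarrow> bool" where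
  "equivalence_functor A B F0 F1 \<longleftrightarrow>
     category_functor A B F0 F1 \<and>
     (\<exists>G0 G1 \<eta> \<epsilon>. category_functor B A G0 G1 \<and>
        natural_isomorphism A A id id (G0 \<circ> F0) (G1 \<circ> F1) \<eta> \<and>
        natural_isomorphism B B (F0 \<circ> G0) (F1 \<circ> G1) id id \<epsilon>)"

section \<open>Strict 2-categories\<close>

record ('o, 'a, 'c) two_cat =
  obj :: "'o set"
  arr :: "'a set"
  cell :: "'c set"
  src1 :: "'a \<Rightarrow> 'o"
  tgt1 :: "'a \<Rightarrow> 'o"
  src2 :: "'c \<Rightarrow> 'a"
  tgt2 :: "'c \<Rightarrow> 'a"
  id1 :: "'o \<Rightarrow> 'a"
  id2 :: "'a \<Rightarrow> 'c"
  comp1 :: "'a \<Rightarrow> 'a \<Rightarrow> 'a" (infixl "\<sharp>\<^sub>1\<index>" 70)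
  hcomp :: "'c \<Rightarrow> 'c \<Rightarrow> 'c" (infixl "\<sharp>\<^sub>2\<index>" 70)
  vcomp :: "'c \<Rightarrow> 'c \<Rightarrow> 'c" (infixl "\<bullet>\<index>" 65)

definition arrow_category :: "('o, 'a, 'c, 'r) two_cat_scheme \<Rightarrow> ('o, 'a) category_data" where
  "arrow_category C = \<lparr>Ob = obj C, Mor = arr C, Dom = src1 C, Cod = tgt1 C,
     Ident = id1 C, Comp = comp1 C\<rparr>"

definition vertical_category :: "('o, 'a, 'c, 'r) two_cat_scheme \<Rightarrow> ('a, 'c) category_data" where
  "vertical_category C = \<lparr>Ob = arr C, Mor = cell C, Dom = src2 C, Cod = tgt2 C,
     Ident = id2 C, Comp = vcomp C\<rparr>"

definition horizontal_category :: "('o, 'a, 'c, 'r) two_cat_scheme \<Rightarrow> ('o, 'c) category_data" where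
  "horizontal_category C = \<lparr>Ob = obj C, Mor = cell C,
     Dom = (\<lambda>a. src1 C (src2 C a)), Cod = (\<lambda>a. tgt1 C (src2 C a)),
     Ident = (\<lambda>X. id2 C (id1 C X)), Comp = hcomp C\<rparr>"

definition hom_category ::
  "('o, 'a, 'c, 'r) two_cat_scheme \<Rightarrow> 'o \<Rightarrow> 'o \<Rightarrow> ('a, 'c) category_data" where
  "hom_category C X Y =
     \<lparr>Ob = {f \<in> arr C. src1 C f = X \<and> tgt1 C f = Y},
      Mor = {a \<in> cell C. src1 C (src2 C a) = X \<and> tgt1 C (src2 C a) = Y},
      Dom = src2 C, Cod = tgt2 C, Ident = id2 C, Comp = vcomp C\<rparr>"

locale strict_2category =
  fixes C :: "('o, 'a, 'c, 'r) two_cat_scheme" (structure)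
  assumes arrow_category: "category (arrow_category C)"
    and vertical_category: "category (vertical_category C)"
    and horizontal_category: "category (horizontal_category C)"
    and globular_src: "a \<in> cell C \<Longrightarrow> src1 C (src2 C a) = src1 C (tgt2 C a)"
    and globular_tgt: "a \<in> cell C \<Longrightarrow> tgt1 C (src2 C a) = tgt1 C (tgt2 C a)"
    and src2_hcomp: "\<lbrakk>a \<in> cell C; b \<in> cell C; tgt1 C (src2 C a) = src1 C (src2 C b)\<rbrakk>
      \<Longrightarrow> src2 C (a \<sharp>\<^sub>2 b) = src2 C a \<sharp>\<^sub>1 src2 C b"
    and tgt2_hcomp: "\<lbrakk>a \<in> cell C; b \<in> cell C; tgt1 C (src2 C a) = src1 C (src2 C b)\<rbrakk>
      \<Longrightarrow> tgt2 C (a \<sharp>\<^sub>2 b) = tgt2 C a \<sharp>\<^sub>1 tgt2 C b"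
    and id2_comp1: "\<lbrakk>f \<in> arr C; g \<in> arr C; tgt1 C f = src1 C g\<rbrakk>
      \<Longrightarrow> id2 C (f \<sharp>\<^sub>1 g) = id2 C f \<sharp>\<^sub>2 id2 C g"
    and interchange: "\<lbrakk>a \<in> cell C; a' \<in> cell C; b \<in> cell C; b' \<in> cell C;
        tgt2 C a = src2 C a'; tgt2 C b = src2 C b'; tgt1 C (src2 C a) = src1 C (src2 C b)\<rbrakk>
      \<Longrightarrow> (a \<bullet> a') \<sharp>\<^sub>2 (b \<bullet> b') = (a \<sharp>\<^sub>2 b) \<bullet> (a' \<sharp>\<^sub>2 b')"

definition hom1 :: "('o, 'a, 'c, 'r) two_cat_scheme \<Rightarrow> 'o \<Rightarrow> 'o \<Rightarrow> 'a set" where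
  "hom1 C X Y = {f \<in> arr C. src1 C f = X \<and> tgt1 C f = Y}"

definition hom2 :: "('o, 'a, 'c, 'r) two_cat_scheme \<Rightarrow> 'a \<Rightarrow> 'a \<Rightarrow> 'c set" where
  "hom2 C f g = {a \<in> cell C. src2 C a = f \<and> tgt2 C a = g}"

definition invertible :: "('o, 'a, 'c, 'r) two_cat_scheme \<Rightarrow> 'c \<Rightarrow> bool" where
  "invertible C a \<longleftrightarrow> isomorphism (vertical_category C) a"

definition vinv :: "('o, 'a, 'c, 'r) two_cat_scheme \<Rightarrow> 'c \<Rightarrow> 'c" where
  "vinv C a = (THE b. inverse_pair (vertical_category C) a b)"

definition equi_arrow :: "('o, 'a, 'c, 'r) two_cat_scheme \<Rightarrow> 'a \<Rightarrow> bool" where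
  "equi_arrow C f \<longleftrightarrow> f \<in> arr C \<and>
     (\<exists>g \<in> hom1 C (tgt1 C f) (src1 C f).
        (\<exists>a \<in> hom2 C (comp1 C f g) (id1 C (src1 C f)). invertible C a) \<and>
        (\<exists>b \<in> hom2 C (comp1 C g f) (id1 C (tgt1 C f)). invertible C b))"

locale strict_2functor = C: strict_2category C + D: strict_2category D
  for C :: "('o, 'a, 'c, 'r) two_cat_scheme" and D :: "('p, 'b, 'd, 's) two_cat_scheme" +
  fixes F0 :: "'o \<Rightarrow> 'p" and F1 :: "'a \<Rightarrow> 'b" and F2 :: "'c \<Rightarrow> 'd"
  assumes functor_arrow: "category_functor (arrow_category C) (arrow_category D) F0 F1"
    and functor_vertical: "category_functor (vertical_category C) (vertical_category D) F1 F2"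
    and functor_horizontal: "category_functor (horizontal_category C) (horizontal_category D) F0 F2"

definition fully_faithful_2functor ::
  "('o, 'a, 'c, 'r) two_cat_scheme \<Rightarrow> ('p, 'b, 'd, 's) two_cat_scheme \<Rightarrow>
   ('o \<Rightarrow> 'p) \<Rightarrow> ('a \<Rightarrow> 'b) \<Rightarrow> ('c \<Rightarrow> 'd) \<Rightarrow> bool" where
  "fully_faithful_2functor C D F0 F1 F2 \<longleftrightarrow>
     strict_2functor C D F0 F1 F2 \<and>
     (\<forall>X\<in>obj C. \<forall>Y\<in>obj C.
        equivalence_functor (hom_category C X Y) (hom_category D (F0 X) (F0 Y)) F1 F2)"

definition product_2cat ::
  "('o, 'a, 'c, 'r) two_cat_scheme \<Rightarrow> ('p, 'b, 'd, 's) two_cat_scheme \<Rightarrow>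
   ('o \<times> 'p, 'a \<times> 'b, 'c \<times> 'd) two_cat" where
  "product_2cat C D =
     \<lparr>obj = obj C \<times> obj D, arr = arr C \<times> arr D, cell = cell C \<times> cell D,
      src1 = map_prod (src1 C) (src1 D), tgt1 = map_prod (tgt1 C) (tgt1 D),
      src2 = map_prod (src2 C) (src2 D), tgt2 = map_prod (tgt2 C) (tgt2 D),
      id1 = map_prod (id1 C) (id1 D), id2 = map_prod (id2 C) (id2 D),
      comp1 = (\<lambda>(f, f') (g, g'). (comp1 C f g, comp1 D f' g')),
      hcomp = (\<lambda>(a, a') (b, b'). (hcomp C a b, hcomp D a' b')),
      vcomp = (\<lambda>(a, a') (b, b'). (vcomp C a b, vcomp D a' b'))\<rparr>"

section \<open>Semi-monoidal 2-categories and units\<close>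

record ('o, 'a, 'c) semi_monoidal_2cat = "('o, 'a, 'c) two_cat" +
  tensor0 :: "'o \<Rightarrow> 'o \<Rightarrow> 'o" (infixl "\<otimes>\<^sub>0\<index>" 75)
  tensor1 :: "'a \<Rightarrow> 'a \<Rightarrow> 'a" (infixl "\<otimes>\<^sub>1\<index>" 75)
  tensor2 :: "'c \<Rightarrow> 'c \<Rightarrow> 'c" (infixl "\<otimes>\<^sub>2\<index>" 75)

locale semi_monoidal_2category = strict_2category C
  for C :: "('o, 'a, 'c) semi_monoidal_2cat" (structure) +
  assumes tensor_2functor: "strict_2functor (product_2cat C C) C
      (\<lambda>(X, Y). X \<otimes>\<^sub>0 Y) (\<lambda>(f, g). f \<otimes>\<^sub>1 g) (\<lambda>(a, b). a \<otimes>\<^sub>2 b)"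
    and tensor0_assoc: "\<lbrakk>X \<in> obj C; Y \<in> obj C; Z \<in> obj C\<rbrakk>
      \<Longrightarrow> (X \<otimes>\<^sub>0 Y) \<otimes>\<^sub>0 Z = X \<otimes>\<^sub>0 (Y \<otimes>\<^sub>0 Z)"
    and tensor1_assoc: "\<lbrakk>f \<in> arr C; g \<in> arr C; h \<in> arr C\<rbrakk>
      \<Longrightarrow> (f \<otimes>\<^sub>1 g) \<otimes>\<^sub>1 h = f \<otimes>\<^sub>1 (g \<otimes>\<^sub>1 h)"
    and tensor2_assoc: "\<lbrakk>a \<in> cell C; b \<in> cell C; c \<in> cell C\<rbrakk>
      \<Longrightarrow> (a \<otimes>\<^sub>2 b) \<otimes>\<^sub>2 c = a \<otimes>\<^sub>2 (b \<otimes>\<^sub>2 c)"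

text \<open>The identity 2-cell of the identity arrow of an object, i.e. the object regarded as a
  2-cell; tensoring with it is the action of \<open>X \<mapsto> IX\<close> and \<open>X \<mapsto> XI\<close> on 2-cells.\<close>

definition obj2 :: "('o, 'a, 'c, 'r) two_cat_scheme \<Rightarrow> 'o \<Rightarrow> 'c" where
  "obj2 C X = id2 C (id1 C X)"

definition cancellable :: "('o, 'a, 'c) semi_monoidal_2cat \<Rightarrow> 'o \<Rightarrow> bool" where
  "cancellable C I \<longleftrightarrow> I \<in> obj C \<and>
     fully_faithful_2functor C C
       (\<lambda>X. I \<otimes>\<^sub>0 X) (\<lambda>f. id1 C I \<otimes>\<^sub>1 f) (\<lambda>a. obj2 C I \<otimes>\<^sub>2 a) \<and>
     fully_faithful_2functor C C
       (\<lambda>X. X \<otimes>\<^sub>0 I) (\<lambda>f. f \<otimes>\<^sub>1 id1 C I) (\<lambda>a. a \<otimes>\<^sub>2 obj2 C I)"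
  for C (structure)

definition unit_object :: "('o, 'a, 'c) semi_monoidal_2cat \<Rightarrow> 'o \<Rightarrow> 'a \<Rightarrow> bool" where
  "unit_object C I \<alpha> \<longleftrightarrow>
     cancellable C I \<and> \<alpha> \<in> hom1 C (I \<otimes>\<^sub>0 I) I \<and> equi_arrow C \<alpha>"
  for C (structure)

definition left_constraint ::
  "('o, 'a, 'c) semi_monoidal_2cat \<Rightarrow> 'o \<Rightarrow> 'a \<Rightarrow> ('o \<Rightarrow> 'a) \<Rightarrow> ('o \<Rightarrow> 'c) \<Rightarrow> bool" where
  "left_constraint C I \<alpha> lam L \<longleftrightarrow>
     (\<forall>X\<in>obj C. lam X \<in> hom1 C (I \<otimes>\<^sub>0 X) X \<and> equi_arrow C (lam X) \<and>
        L X \<in> hom2 C (id1 C I \<otimes>\<^sub>1 lam X) (\<alpha> \<otimes>\<^sub>1 id1 C X) \<and> invertible C (L X))"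
  for C (structure)

definition right_constraint ::
  "('o, 'a, 'c) semi_monoidal_2cat \<Rightarrow> 'o \<Rightarrow> 'a \<Rightarrow> ('o \<Rightarrow> 'a) \<Rightarrow> ('o \<Rightarrow> 'c) \<Rightarrow> bool" where
  "right_constraint C I \<alpha> rho R \<longleftrightarrow>
     (\<forall>X\<in>obj C. rho X \<in> hom1 C (X \<otimes>\<^sub>0 I) X \<and> equi_arrow C (rho X) \<and>
        R X \<in> hom2 C (id1 C X \<otimes>\<^sub>1 \<alpha>) (rho X \<otimes>\<^sub>1 id1 C I) \<and> invertible C (R X))"
  for C (structure)

text \<open>The 2-cells \<open>K\<close>, \<open>K\<^sup>\<lambda>\<close> and \<open>K\<^sup>\<rho>\<close> are definite descriptions: each is the unique invertible
  2-cell with the given source and target that satisfies its defining equation. In the first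
  equation, the vertical composite makes sense because \<open>\<rho>\<^sub>XIY # X\<lambda>\<^sub>Y = XI\<lambda>\<^sub>Y # \<rho>\<^sub>XY\<close> by functoriality
  of the tensor product.\<close>

definition K_cell ::
  "('o, 'a, 'c) semi_monoidal_2cat \<Rightarrow> 'a \<Rightarrow> ('o \<Rightarrow> 'a) \<Rightarrow> ('o \<Rightarrow> 'c) \<Rightarrow> ('o \<Rightarrow> 'a) \<Rightarrow> ('o \<Rightarrow> 'c)
   \<Rightarrow> 'o \<Rightarrow> 'o \<Rightarrow> 'c" where
  "K_cell C \<alpha> lam L rho R X Y =
     (THE k. k \<in> hom2 C (id1 C X \<otimes>\<^sub>1 lam Y) (rho X \<otimes>\<^sub>1 id1 C Y) \<and> invertible C k \<and>
        ((R X \<otimes>\<^sub>2 obj2 C Y) \<sharp>\<^sub>2 id2 C (id1 C X \<otimes>\<^sub>1 lam Y))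
          \<bullet> ((obj2 C X \<otimes>\<^sub>2 L Y) \<sharp>\<^sub>2 id2 C (rho X \<otimes>\<^sub>1 id1 C Y))
        = id2 C (id1 C X \<otimes>\<^sub>1 \<alpha> \<otimes>\<^sub>1 id1 C Y) \<sharp>\<^sub>2 k)"
  for C (structure)

definition K_lam ::
  "('o, 'a, 'c) semi_monoidal_2cat \<Rightarrow> 'o \<Rightarrow> ('o \<Rightarrow> 'a) \<Rightarrow> ('o \<Rightarrow> 'c) \<Rightarrow> 'o \<Rightarrow> 'o \<Rightarrow> 'c" where
  "K_lam C I lam L X Y =
     (THE k. k \<in> hom2 C (lam (X \<otimes>\<^sub>0 Y)) (lam X \<otimes>\<^sub>1 id1 C Y) \<and> invertible C k \<and>
        obj2 C I \<otimes>\<^sub>2 k = L (X \<otimes>\<^sub>0 Y) \<bullet> (vinv C (L X) \<otimes>\<^sub>2 obj2 C Y))"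
  for C (structure)

definition K_rho ::
  "('o, 'a, 'c) semi_monoidal_2cat \<Rightarrow> 'o \<Rightarrow> ('o \<Rightarrow> 'a) \<Rightarrow> ('o \<Rightarrow> 'c) \<Rightarrow> 'o \<Rightarrow> 'o \<Rightarrow> 'c" where
  "K_rho C I rho R X Y =
     (THE k. k \<in> hom2 C (id1 C X \<otimes>\<^sub>1 rho Y) (rho (X \<otimes>\<^sub>0 Y)) \<and> invertible C k \<and>
        k \<otimes>\<^sub>2 obj2 C I = (obj2 C X \<otimes>\<^sub>2 vinv C (R Y)) \<bullet> R (X \<otimes>\<^sub>0 Y))"
  for C (structure)

end

(* By uniqueness of K it suffices to compare both sides after whiskering with the equi-arrow
   X\<alpha>YZ (respectively XY\<alpha>Z). In the first identity the interchange law slides XK\<^sup>\<lambda> past R_X YZ,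
   turning it into XIK\<^sup>\<lambda> # \<rho>_X YZ; the defining equation of K\<^sup>\<lambda> then produces X L_Y\<^sup>-\<^sup>1 Z, which
   cancels the factor X L_Y Z coming from K_{X,Y}Z. In the second identity K\<^sup>\<rho>Z is slid past XYL_Z
   and R_Y\<^sup>-\<^sup>1 cancels R_Y in the same way. *)

theory Submission
  imports Defs
begin

section \<open>Equivalences of categories\<close>

text \<open>The three cells are definite descriptions, so nothing can be computed with them before
  each is shown to exist and to be unique. All three cases rest on one fact: an equivalence of
  categories is bijective on isomorphisms between given objects. For \<open>Kl\<close> and
  \<open>Kr\<close> the equivalence is cancellability of I. For \<open>K\<close> it has to be built:
  it is precomposition with an equi-arrow, and its quasi-inverse is precomposition with a
  pseudo-inverse. Each identity uses slides of two kinds. Exchanging two 2-cells is interchange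
  inside the 2-category. Moving a 2-cell past an arrow that lives on the other tensor factor is
  functoriality of the tensor, and it is this slide that produces the factor I which the defining
  equations of \<open>Kl\<close> and \<open>Kr\<close> require. It changes the order of composition
  of the bordering arrows, so the matching equations between arrows have to be carried along before
  the 2-cells can be composed.\<close>

context category
begin

text \<open>The object is a separate variable tied by an equation, so that rewriting also reaches
  identities whose object is not literally \<open>Dom A f\<close>.\<close>

lemma Ident_left_eq: "f \<in> Mor A \<Longrightarrow> Dom A f = x \<Longrightarrow> Comp A (Ident A x) f = f"
  using Ident_left by blast

lemma Ident_right_eq: "f \<in> Mor A \<Longrightarrow> Cod A f = x \<Longrightarrow> Comp A f (Ident A x) = f"
  using Ident_right by blast

lemma inverse_pairD:
  assumes "inverse_pair A f g"
  shows "f \<in> Mor A" "g \<in> Mor A" "Dom A g = Cod A f" "Cod A g = Dom A f"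
    "Comp A f g = Ident A (Dom A f)" "Comp A g f = Ident A (Cod A f)"
  using assms by (simp_all add: inverse_pair_def)

lemma inverse_pair_unique:
  assumes "inverse_pair A f g" and "inverse_pair A f h"
  shows "g = h"
proof -
  note g = inverse_pairD[OF assms(1)] and h = inverse_pairD[OF assms(2)]
  have "g = Comp A g (Comp A f h)"
    using g h by (simp add: Ident_right_eq)
  also have "\<dots> = Comp A (Comp A g f) h"
    using g h by (intro Comp_assoc[symmetric]) simp_all
  also have "\<dots> = h"
    using g h by (simp add: Ident_left_eq)
  finally show ?thesis .
qed

lemma inverse_pair_Comp:
  assumes "inverse_pair A f f'" and "inverse_pair A g g'" and fg: "Cod A f = Dom A g"
  shows "inverse_pair A (Comp A f g) (Comp A g' f')"
proof -
  note f = inverse_pairD[OF assms(1)] and g = inverse_pairD[OF assms(2)]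
  note simps = Comp_assoc Comp_closed Dom_Comp Cod_Comp
  have "Comp A (Comp A f g) (Comp A g' f') = Comp A f (Comp A (Comp A g g') f')"
    using f(1-4) g(1-4) fg by (simp add: simps)
  also have "\<dots> = Ident A (Dom A f)"
    using f g fg by (simp add: Ident_left_eq)
  finally have 1: "Comp A (Comp A f g) (Comp A g' f') = Ident A (Dom A f)" .
  have "Comp A (Comp A g' f') (Comp A f g) = Comp A g' (Comp A (Comp A f' f) g)"
    using f(1-4) g(1-4) fg by (simp add: simps)
  also have "\<dots> = Ident A (Cod A g)"
    using f g fg by (simp add: Ident_left_eq)
  finally show ?thesis
    using 1 f(1-4) g(1-4) fg by (simp add: inverse_pair_def Comp_closed Dom_Comp Cod_Comp)
qed

lemma isomorphism_Comp:
  assumes "isomorphism A f" and "isomorphism A g" and "Cod A f = Dom A g"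
  shows "isomorphism A (Comp A f g)"
  using assms inverse_pair_Comp unfolding isomorphism_def by blast

lemma inverse_pair_sym: "inverse_pair A f g \<Longrightarrow> inverse_pair A g f"
  by (auto simp: inverse_pair_def)

lemma isomorphism_cancel_left:
  assumes "isomorphism A h" and "f \<in> Mor A" and "g \<in> Mor A"
    and "Cod A h = Dom A f" and "Cod A h = Dom A g" and eq: "Comp A h f = Comp A h g"
  shows "f = g"
proof -
  obtain k where "inverse_pair A h k" using assms(1) by (auto simp: isomorphism_def)
  note k = inverse_pairD[OF this]
  have "f = Comp A (Comp A k h) f"
    using k(6) assms(2,4) by (simp add: Ident_left_eq)
  also have "\<dots> = Comp A (Comp A k h) g"
    using k(1-4) assms by (simp add: Comp_assoc)
  also have "\<dots> = g"
    using k(6) assms(3,5) by (simp add: Ident_left_eq)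
  finally show ?thesis .
qed

lemma isomorphism_cancel_right:
  assumes "isomorphism A h" and "f \<in> Mor A" and "g \<in> Mor A"
    and "Cod A f = Dom A h" and "Cod A g = Dom A h" and eq: "Comp A f h = Comp A g h"
  shows "f = g"
proof -
  obtain k where "inverse_pair A h k" using assms(1) by (auto simp: isomorphism_def)
  note k = inverse_pairD[OF this]
  have "f = Comp A f (Comp A h k)"
    using k(5) assms(2,4) by (simp add: Ident_right_eq)
  also have "\<dots> = Comp A g (Comp A h k)"
    using k(1-4) assms Comp_assoc[of f h k] Comp_assoc[of g h k] by simp
  also have "\<dots> = g"
    using k(5) assms(3,5) by (simp add: Ident_right_eq)
  finally show ?thesis .
qed

section \<open>Full faithfulness of equivalences, on isomorphisms\<close>

lemma faithful_of_natural_isomorphism_from_id: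
  assumes "natural_isomorphism A A id id H0 H1 \<eta>"
    and "f \<in> Mor A" and "g \<in> Mor A" and "Dom A f = Dom A g" and "Cod A f = Cod A g"
    and "H1 f = H1 g"
  shows "f = g"
proof -
  have \<eta>: "isomorphism A (\<eta> (Cod A f))" "Dom A (\<eta> (Cod A f)) = Cod A f"
    using assms(1,2) Cod_closed[of f] by (simp_all add: natural_isomorphism_def)
  \<comment> \<open>Naturality turns both sides into \<open>\<eta> (Dom A f)\<close> followed by
    \<open>H1 f\<close> or \<open>H1 g\<close>, and these agree; the common component at the
    codomain is then cancelled.\<close>
  have "Comp A f (\<eta> (Cod A f)) = Comp A g (\<eta> (Cod A f))"
    using assms unfolding natural_isomorphism_def by (metis id_apply)
  then show ?thesis
    by (rule isomorphism_cancel_right[OF \<eta>(1) assms(2,3), rotated 2])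
      (simp_all add: \<eta> assms(5)[symmetric])
qed

text \<open>The mirror image: the component at the common domain is cancelled on the left. With
  \<open>H1\<close> equal to \<open>F1 \<circ> G1\<close> it yields faithfulness of the
  quasi-inverse \<open>G1\<close>.\<close>

lemma faithful_of_natural_isomorphism_to_id:
  assumes "natural_isomorphism A A H0 H1 id id \<epsilon>"
    and "f \<in> Mor A" and "g \<in> Mor A" and "Dom A f = Dom A g" and "Cod A f = Cod A g"
    and "H1 f = H1 g"
  shows "f = g"
proof -
  have \<epsilon>: "isomorphism A (\<epsilon> (Dom A f))" "Cod A (\<epsilon> (Dom A f)) = Dom A f"
    using assms(1,2) Dom_closed[of f] by (simp_all add: natural_isomorphism_def)
  have "Comp A (\<epsilon> (Dom A f)) f = Comp A (\<epsilon> (Dom A f)) g"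
    using assms unfolding natural_isomorphism_def by (metis id_apply)
  then show ?thesis
    by (rule isomorphism_cancel_left[OF \<epsilon>(1) assms(2,3), rotated 2])
      (simp_all add: \<epsilon> assms(4)[symmetric])
qed

end

lemma (in category_functor) inverse_pair_image:
  "inverse_pair A f g \<Longrightarrow> inverse_pair B (F1 f) (F1 g)"
  unfolding inverse_pair_def
  by (metis F1_Cod F1_Comp F1_Dom F1_Ident F1_closed A.Dom_closed)

lemma (in category_functor) isomorphism_image:
  "isomorphism A f \<Longrightarrow> isomorphism B (F1 f)"
  using inverse_pair_image by (auto simp: isomorphism_def)

text \<open>The classical argument that an equivalence is fully faithful, carried out for
  isomorphisms only because the descriptions of \<open>K\<close>, \<open>Kl\<close> and
  \<open>Kr\<close> ask for invertible cells. Uniqueness is faithfulness of \<open>F1\<close>, read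
  off from \<open>\<eta>\<close>; existence uses faithfulness of \<open>G1\<close>, read off from
  \<open>\<epsilon>\<close>.\<close>

lemma equivalence_functor_ex1_isomorphism:
  assumes eqv: "equivalence_functor A B F0 F1" and x: "x \<in> Ob A" and y: "y \<in> Ob A"
    and m: "isomorphism B m" "Dom B m = F0 x" "Cod B m = F0 y"
  shows "\<exists>!k. k \<in> Mor A \<and> Dom A k = x \<and> Cod A k = y \<and> isomorphism A k \<and> F1 k = m"
proof -
  obtain G0 G1 \<eta> \<epsilon> where F: "category_functor A B F0 F1" and G: "category_functor B A G0 G1"
    and \<eta>: "natural_isomorphism A A id id (G0 \<circ> F0) (G1 \<circ> F1) \<eta>"
    and \<epsilon>: "natural_isomorphism B B (F0 \<circ> G0) (F1 \<circ> G1) id id \<epsilon>"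
    using eqv unfolding equivalence_functor_def by blast
  interpret F: category_functor A B F0 F1 by (rule F)
  interpret G: category_functor B A G0 G1 by (rule G)
  have mM: "m \<in> Mor B" using m(1) by (auto simp: isomorphism_def inverse_pair_def)
  have \<eta>x: "isomorphism A (\<eta> x)" "Dom A (\<eta> x) = x" "Cod A (\<eta> x) = G0 (F0 x)"
    and \<eta>y: "isomorphism A (\<eta> y)" "Dom A (\<eta> y) = y" "Cod A (\<eta> y) = G0 (F0 y)"
    using \<eta> x y by (auto simp: natural_isomorphism_def)
  obtain i where i: "inverse_pair A (\<eta> y) i" using \<eta>y by (auto simp: isomorphism_def)
  note ip = i[unfolded inverse_pair_def]
  have \<eta>xM: "\<eta> x \<in> Mor A" using \<eta>x(1) by (auto simp: isomorphism_def inverse_pair_def)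
  have i_iso: "isomorphism A i"
    using i F.A.inverse_pair_sym by (auto simp: isomorphism_def)
  \<comment> \<open>The preimage is forced: naturality of \<open>\<eta>\<close> at any preimage k of
    m says that k followed by \<open>\<eta> y\<close> equals \<open>\<eta> x\<close> followed by
    \<open>G1 m\<close>. Hence k is this composite followed by the inverse \<open>i\<close> of
    \<open>\<eta> y\<close>; being a composite of isomorphisms, it is one itself.\<close>
  define n where "n = Comp A (\<eta> x) (G1 m)"
  have nM: "n \<in> Mor A" "Dom A n = x" "Cod A n = G0 (F0 y)" "isomorphism A n"
    using \<eta>x \<eta>xM m mM
    by (simp_all add: n_def F.A.Comp_closed F.A.Dom_Comp F.A.Cod_Comp F.A.isomorphism_Comp
        G.F1_closed G.F1_Dom G.F1_Cod G.isomorphism_image)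
  define k where "k = Comp A n i"
  have kM: "k \<in> Mor A" "Dom A k = x" "Cod A k = y" "isomorphism A k"
    using nM ip \<eta>y i_iso
    by (simp_all add: k_def F.A.Comp_closed F.A.Dom_Comp F.A.Cod_Comp F.A.isomorphism_Comp)
  have "Comp A (\<eta> x) (G1 (F1 k)) = Comp A k (\<eta> y)"
    using \<eta> kM by (auto simp: natural_isomorphism_def)
  also have "\<dots> = Comp A n (Comp A i (\<eta> y))"
    using nM ip \<eta>y by (simp add: k_def F.A.Comp_assoc)
  also have "\<dots> = Comp A (\<eta> x) (G1 m)"
    using nM ip \<eta>y F.A.Ident_right[of n] by (simp add: n_def)
  finally have "G1 (F1 k) = G1 m"
    using F.A.isomorphism_cancel_left[of "\<eta> x" "G1 (F1 k)" "G1 m"] \<eta>x kM mM m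
    by (simp add: G.F1_closed G.F1_Dom F.F1_closed F.F1_Dom)
  \<comment> \<open>\<open>F1 k\<close> and \<open>m\<close> are parallel and have the same image
    under \<open>G1\<close>, hence under \<open>F1 \<circ> G1\<close>; now \<open>\<epsilon>\<close>
    identifies them.\<close>
  then have Fk: "F1 k = m"
    using F.B.faithful_of_natural_isomorphism_to_id[OF \<epsilon>, of "F1 k" m] kM mM m
    by (simp add: F.F1_closed F.F1_Dom F.F1_Cod)
  show ?thesis
  proof (rule ex1I[of _ k])
    show "k \<in> Mor A \<and> Dom A k = x \<and> Cod A k = y \<and> isomorphism A k \<and> F1 k = m"
      using kM Fk by simp
    fix l assume "l \<in> Mor A \<and> Dom A l = x \<and> Cod A l = y \<and> isomorphism A l \<and> F1 l = m"
    then show "l = k"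
      using F.A.faithful_of_natural_isomorphism_from_id[OF \<eta>, of l k] kM Fk by simp
  qed
qed

section \<open>Strict 2-categories\<close>

context strict_2category
begin

sublocale A: category "arrow_category C" by (rule arrow_category)
sublocale V: category "vertical_category C" by (rule vertical_category)
sublocale H: category "horizontal_category C" by (rule horizontal_category)

lemma arr_simps [simp]:
  "f \<in> arr C \<Longrightarrow> src1 C f \<in> obj C"
  "f \<in> arr C \<Longrightarrow> tgt1 C f \<in> obj C"
  "X \<in> obj C \<Longrightarrow> id1 C X \<in> arr C"
  "X \<in> obj C \<Longrightarrow> src1 C (id1 C X) = X"
  "X \<in> obj C \<Longrightarrow> tgt1 C (id1 C X) = X"
  "\<lbrakk>f \<in> arr C; g \<in> arr C; tgt1 C f = src1 C g\<rbrakk> \<Longrightarrow> f \<sharp>\<^sub>1 g \<in> arr C"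
  "\<lbrakk>f \<in> arr C; g \<in> arr C; tgt1 C f = src1 C g\<rbrakk> \<Longrightarrow> src1 C (f \<sharp>\<^sub>1 g) = src1 C f"
  "\<lbrakk>f \<in> arr C; g \<in> arr C; tgt1 C f = src1 C g\<rbrakk> \<Longrightarrow> tgt1 C (f \<sharp>\<^sub>1 g) = tgt1 C g"
  "f \<in> arr C \<Longrightarrow> src1 C f = X \<Longrightarrow> id1 C X \<sharp>\<^sub>1 f = f"
  "f \<in> arr C \<Longrightarrow> tgt1 C f = X \<Longrightarrow> f \<sharp>\<^sub>1 id1 C X = f"
  using A.Dom_closed A.Cod_closed A.Ident_closed A.Dom_Ident A.Cod_Ident A.Comp_closed A.Dom_Comp
    A.Cod_Comp A.Ident_left A.Ident_right
  by (auto simp: arrow_category_def)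

lemma comp1_assoc:
  "\<lbrakk>f \<in> arr C; g \<in> arr C; h \<in> arr C; tgt1 C f = src1 C g; tgt1 C g = src1 C h\<rbrakk>
    \<Longrightarrow> f \<sharp>\<^sub>1 g \<sharp>\<^sub>1 h = f \<sharp>\<^sub>1 (g \<sharp>\<^sub>1 h)"
  using A.Comp_assoc[of f g h] by (simp add: arrow_category_def)

lemma hom2D:
  assumes "a \<in> hom2 C f g"
  shows "a \<in> cell C" "src2 C a = f" "tgt2 C a = g" "f \<in> arr C" "g \<in> arr C"
    "src1 C g = src1 C f" "tgt1 C g = tgt1 C f"
  using assms V.Dom_closed[of a] V.Cod_closed[of a] globular_src[of a] globular_tgt[of a]
  by (auto simp: hom2_def vertical_category_def)

lemma id2_hom2 [simp]: "f \<in> arr C \<Longrightarrow> id2 C f \<in> hom2 C f f"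
  using V.Ident_closed V.Dom_Ident V.Cod_Ident by (simp add: hom2_def vertical_category_def)

lemma obj2_hom2: "X \<in> obj C \<Longrightarrow> obj2 C X \<in> hom2 C (id1 C X) (id1 C X)"
  by (simp add: obj2_def)

lemma vcomp_hom2: "a \<in> hom2 C f g \<Longrightarrow> b \<in> hom2 C g h \<Longrightarrow> a \<bullet> b \<in> hom2 C f h"
  using V.Comp_closed[of a b] V.Dom_Comp[of a b] V.Cod_Comp[of a b]
  by (simp add: hom2_def vertical_category_def)

lemma vcomp_assoc:
  "\<lbrakk>a \<in> hom2 C f g; b \<in> hom2 C g h; c \<in> hom2 C h k\<rbrakk> \<Longrightarrow> a \<bullet> b \<bullet> c = a \<bullet> (b \<bullet> c)"
  using V.Comp_assoc[of a b c] by (simp add: hom2_def vertical_category_def)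

lemma id2_vcomp: "a \<in> hom2 C f g \<Longrightarrow> id2 C f \<bullet> a = a"
  using V.Ident_left[of a] by (simp add: hom2_def vertical_category_def)

lemma vcomp_id2: "a \<in> hom2 C f g \<Longrightarrow> a \<bullet> id2 C g = a"
  using V.Ident_right[of a] by (simp add: hom2_def vertical_category_def)

lemma hcomp_hom2:
  assumes "a \<in> hom2 C f g" and "b \<in> hom2 C f' g'" and "tgt1 C f = src1 C f'"
  shows "a \<sharp>\<^sub>2 b \<in> hom2 C (f \<sharp>\<^sub>1 f') (g \<sharp>\<^sub>1 g')"
  using assms H.Comp_closed[of a b] src2_hcomp[of a b] tgt2_hcomp[of a b]
  by (simp add: hom2_def horizontal_category_def)

lemma whisker_left_hom2:
  "a \<in> hom2 C g h \<Longrightarrow> f \<in> arr C \<Longrightarrow> tgt1 C f = src1 C g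
    \<Longrightarrow> id2 C f \<sharp>\<^sub>2 a \<in> hom2 C (f \<sharp>\<^sub>1 g) (f \<sharp>\<^sub>1 h)"
  by (rule hcomp_hom2) simp_all

lemma whisker_right_hom2:
  "a \<in> hom2 C g h \<Longrightarrow> f \<in> arr C \<Longrightarrow> tgt1 C g = src1 C f
    \<Longrightarrow> a \<sharp>\<^sub>2 id2 C f \<in> hom2 C (g \<sharp>\<^sub>1 f) (h \<sharp>\<^sub>1 f)"
  by (rule hcomp_hom2) simp_all

lemma hcomp_assoc:
  assumes "a \<in> hom2 C f f'" and "b \<in> hom2 C g g'" and "c \<in> hom2 C h h'"
    and "tgt1 C f = src1 C g" and "tgt1 C g = src1 C h"
  shows "a \<sharp>\<^sub>2 b \<sharp>\<^sub>2 c = a \<sharp>\<^sub>2 (b \<sharp>\<^sub>2 c)"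
  using assms H.Comp_assoc[of a b c] by (simp add: hom2_def horizontal_category_def)

lemma obj2_hcomp: "a \<in> hom2 C f g \<Longrightarrow> src1 C f = X \<Longrightarrow> obj2 C X \<sharp>\<^sub>2 a = a"
  using H.Ident_left[of a] by (auto simp: hom2_def horizontal_category_def obj2_def)

lemma hcomp_obj2: "a \<in> hom2 C f g \<Longrightarrow> tgt1 C f = X \<Longrightarrow> a \<sharp>\<^sub>2 obj2 C X = a"
  using H.Ident_right[of a] by (auto simp: hom2_def horizontal_category_def obj2_def)

lemma interchange_hom2:
  assumes "a \<in> hom2 C f g" and "a' \<in> hom2 C g h" and "b \<in> hom2 C f' g'" and "b' \<in> hom2 C g' h'"
    and "tgt1 C f = src1 C f'"
  shows "(a \<bullet> a') \<sharp>\<^sub>2 (b \<bullet> b') = (a \<sharp>\<^sub>2 b) \<bullet> (a' \<sharp>\<^sub>2 b')"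
  using assms interchange[of a a' b b'] by (simp add: hom2_def)

text \<open>Pad a and b with identity 2-cells on opposite ends and apply interchange. Together with
  the factorization in the other order, which follows in the same way, this is what lets two 2-cells
  slide past each other.\<close>

lemma hcomp_eq_left_right:
  assumes a: "a \<in> hom2 C f g" and b: "b \<in> hom2 C f' g'" and "tgt1 C f = src1 C f'"
  shows "a \<sharp>\<^sub>2 b = (a \<sharp>\<^sub>2 id2 C f') \<bullet> (id2 C g \<sharp>\<^sub>2 b)"
  using interchange_hom2[OF a id2_hom2 id2_hom2 b] assms hom2D[OF a] hom2D[OF b]
  by (simp add: id2_vcomp[OF b] vcomp_id2[OF a])

lemma hcomp_eq_right_left:
  assumes a: "a \<in> hom2 C f g" and b: "b \<in> hom2 C f' g'" and "tgt1 C f = src1 C f'"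
  shows "a \<sharp>\<^sub>2 b = (id2 C f \<sharp>\<^sub>2 b) \<bullet> (a \<sharp>\<^sub>2 id2 C g')"
  using interchange_hom2[OF id2_hom2 a b id2_hom2] assms hom2D[OF a] hom2D[OF b]
  by (simp add: id2_vcomp[OF a] vcomp_id2[OF b])

lemma whisker_left_vcomp:
  assumes "a \<in> hom2 C g h" and "b \<in> hom2 C h k" and "f \<in> arr C" and "tgt1 C f = src1 C g"
  shows "id2 C f \<sharp>\<^sub>2 (a \<bullet> b) = (id2 C f \<sharp>\<^sub>2 a) \<bullet> (id2 C f \<sharp>\<^sub>2 b)"
  using interchange_hom2[of "id2 C f" f f "id2 C f" f a g h b k] assms
  by (simp add: vcomp_id2[of _ f f])

lemma whisker_right_vcomp:
  assumes "a \<in> hom2 C g h" and "b \<in> hom2 C h k" and "f \<in> arr C" and "tgt1 C g = src1 C f"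
  shows "(a \<bullet> b) \<sharp>\<^sub>2 id2 C f = (a \<sharp>\<^sub>2 id2 C f) \<bullet> (b \<sharp>\<^sub>2 id2 C f)"
  using interchange_hom2[of a g h b k "id2 C f" f f "id2 C f" f] assms
  by (simp add: vcomp_id2[of _ f f])

section \<open>Invertible 2-cells and their inverses\<close>

lemma inverse_pair_vertical_iff:
  "inverse_pair (vertical_category C) a b \<longleftrightarrow>
    (\<exists>f g. a \<in> hom2 C f g \<and> b \<in> hom2 C g f \<and> a \<bullet> b = id2 C f \<and> b \<bullet> a = id2 C g)"
  unfolding inverse_pair_def by (auto simp: hom2_def vertical_category_def)

lemma invertibleE:
  assumes "invertible C a" and "a \<in> hom2 C f g"
  obtains b where "b \<in> hom2 C g f" and "a \<bullet> b = id2 C f" and "b \<bullet> a = id2 C g"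
  using assms unfolding invertible_def isomorphism_def inverse_pair_vertical_iff hom2_def by auto

lemma invertibleI:
  "\<lbrakk>a \<in> hom2 C f g; b \<in> hom2 C g f; a \<bullet> b = id2 C f; b \<bullet> a = id2 C g\<rbrakk> \<Longrightarrow> invertible C a"
  unfolding invertible_def isomorphism_def inverse_pair_vertical_iff by blast

lemma vinv:
  assumes "invertible C a" and a: "a \<in> hom2 C f g"
  shows "vinv C a \<in> hom2 C g f" "a \<bullet> vinv C a = id2 C f" "vinv C a \<bullet> a = id2 C g"
proof -
  have "\<exists>!b. inverse_pair (vertical_category C) a b"
    using assms V.inverse_pair_unique unfolding invertible_def isomorphism_def by blast
  then have "inverse_pair (vertical_category C) a (vinv C a)"
    unfolding vinv_def by (rule theI')
  then show "vinv C a \<in> hom2 C g f" "a \<bullet> vinv C a = id2 C f" "vinv C a \<bullet> a = id2 C g"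
    using a unfolding inverse_pair_vertical_iff hom2_def by auto
qed

lemma invertible_vinv:
  assumes "invertible C a" and "a \<in> hom2 C f g"
  shows "invertible C (vinv C a)"
  using vinv[OF assms] assms(2) by (intro invertibleI)

lemma invertible_id2: "f \<in> arr C \<Longrightarrow> invertible C (id2 C f)"
  using invertibleI[of "id2 C f" f f "id2 C f"] by (simp add: vcomp_id2[of _ f f])

lemma invertible_obj2: "X \<in> obj C \<Longrightarrow> invertible C (obj2 C X)"
  by (simp add: obj2_def invertible_id2)

lemma invertible_vcomp:
  assumes "invertible C a" and "invertible C b" and "a \<in> hom2 C f g" and "b \<in> hom2 C g h"
  shows "invertible C (a \<bullet> b)"
  using assms V.isomorphism_Comp[of a b]
  by (simp add: invertible_def vertical_category_def hom2_def)

text \<open>By interchange, the horizontal composite of the inverses is the inverse; globularity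
  makes the inverses horizontally composable.\<close>

lemma invertible_hcomp:
  assumes a: "invertible C a" "a \<in> hom2 C f g" and b: "invertible C b" "b \<in> hom2 C f' g'"
    and fg: "tgt1 C f = src1 C f'"
  shows "invertible C (a \<sharp>\<^sub>2 b)"
proof (rule invertibleI)
  note va = vinv[OF a] and vb = vinv[OF b]
  note D = hom2D[OF a(2)] hom2D[OF b(2)]
  show "a \<sharp>\<^sub>2 b \<in> hom2 C (f \<sharp>\<^sub>1 f') (g \<sharp>\<^sub>1 g')"
    by (rule hcomp_hom2[OF a(2) b(2) fg])
  show "vinv C a \<sharp>\<^sub>2 vinv C b \<in> hom2 C (g \<sharp>\<^sub>1 g') (f \<sharp>\<^sub>1 f')"
    using va vb fg D by (intro hcomp_hom2) simp_all
  show "(a \<sharp>\<^sub>2 b) \<bullet> (vinv C a \<sharp>\<^sub>2 vinv C b) = id2 C (f \<sharp>\<^sub>1 f')"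
    using interchange_hom2[OF a(2) va(1) b(2) vb(1) fg] va vb fg D by (simp add: id2_comp1)
  show "(vinv C a \<sharp>\<^sub>2 vinv C b) \<bullet> (a \<sharp>\<^sub>2 b) = id2 C (g \<sharp>\<^sub>1 g')"
    using interchange_hom2[OF va(1) a(2) vb(1) b(2)] va vb fg D by (simp add: id2_comp1)
qed

section \<open>Hom categories and whiskering by an equi-arrow\<close>

lemma hom_category_simps:
  "f \<in> Ob (hom_category C X Y) \<longleftrightarrow> f \<in> arr C \<and> src1 C f = X \<and> tgt1 C f = Y"
  "a \<in> Mor (hom_category C X Y) \<longleftrightarrow>
    a \<in> cell C \<and> src1 C (src2 C a) = X \<and> tgt1 C (src2 C a) = Y"
  "Dom (hom_category C X Y) = src2 C"
  "Cod (hom_category C X Y) = tgt2 C"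
  "Ident (hom_category C X Y) = id2 C"
  "Comp (hom_category C X Y) = vcomp C"
  by (auto simp: hom_category_def)

lemma cell_hom2: "a \<in> cell C \<Longrightarrow> a \<in> hom2 C (src2 C a) (tgt2 C a)"
  by (simp add: hom2_def)

text \<open>A hom category is cut out of the vertical category by fixing the end objects, so its
  laws are inherited. What remains is closure, and there globularity ensures that the target arrow
  of a 2-cell has the same end objects as its source arrow.\<close>

lemma category_hom_category: "category (hom_category C X Y)"
proof
  fix a assume "a \<in> Mor (hom_category C X Y)"
  then have a: "a \<in> cell C" "src1 C (src2 C a) = X" "tgt1 C (src2 C a) = Y"
    by (simp_all add: hom_category_simps)
  note D = hom2D[OF cell_hom2[OF a(1)]]
  show "Dom (hom_category C X Y) a \<in> Ob (hom_category C X Y)"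
    "Cod (hom_category C X Y) a \<in> Ob (hom_category C X Y)"
    using a D by (simp_all add: hom_category_simps)
  show "Comp (hom_category C X Y) (Ident (hom_category C X Y) (Dom (hom_category C X Y) a)) a = a"
    "Comp (hom_category C X Y) a (Ident (hom_category C X Y) (Cod (hom_category C X Y) a)) = a"
    using id2_vcomp[OF cell_hom2[OF a(1)]] vcomp_id2[OF cell_hom2[OF a(1)]]
    by (simp_all add: hom_category_simps)
  fix b assume "b \<in> Mor (hom_category C X Y)"
    and "Cod (hom_category C X Y) a = Dom (hom_category C X Y) b"
  then have b: "b \<in> hom2 C (tgt2 C a) (tgt2 C b)" and "tgt2 C a = src2 C b"
    by (simp_all add: hom_category_simps hom2_def)
  note ab = hom2D[OF vcomp_hom2[OF cell_hom2[OF a(1)] b]]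
  show "Comp (hom_category C X Y) a b \<in> Mor (hom_category C X Y)"
    "Dom (hom_category C X Y) (Comp (hom_category C X Y) a b) = Dom (hom_category C X Y) a"
    "Cod (hom_category C X Y) (Comp (hom_category C X Y) a b) = Cod (hom_category C X Y) b"
    using ab a by (simp_all add: hom_category_simps)
  fix c assume "c \<in> Mor (hom_category C X Y)"
    and "Cod (hom_category C X Y) b = Dom (hom_category C X Y) c"
  then have c: "c \<in> hom2 C (tgt2 C b) (tgt2 C c)"
    by (simp add: hom_category_simps hom2_def)
  show "Comp (hom_category C X Y) (Comp (hom_category C X Y) a b) c =
      Comp (hom_category C X Y) a (Comp (hom_category C X Y) b c)"
    using vcomp_assoc[OF cell_hom2[OF a(1)] b c] by (simp add: hom_category_simps)
next
  fix f assume "f \<in> Ob (hom_category C X Y)"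
  then show "Ident (hom_category C X Y) f \<in> Mor (hom_category C X Y)"
    "Dom (hom_category C X Y) (Ident (hom_category C X Y) f) = f"
    "Cod (hom_category C X Y) (Ident (hom_category C X Y) f) = f"
    using hom2D[OF id2_hom2[of f]] by (simp_all add: hom_category_simps)
qed

text \<open>A vertical inverse runs between the same two arrows in the opposite direction, so it
  stays in the hom category. This connects \<open>invertible\<close>, which refers to all 2-cells at
  once, with equivalences, which are stated one hom category at a time.\<close>

lemma isomorphism_hom_category_iff:
  assumes "a \<in> hom2 C f g" and "src1 C f = X" and "tgt1 C f = Y"
  shows "isomorphism (hom_category C X Y) a \<longleftrightarrow> invertible C a"
proof
  assume "isomorphism (hom_category C X Y) a"
  then show "invertible C a"
    unfolding isomorphism_def invertible_def inverse_pair_def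
    by (auto simp: hom_category_simps vertical_category_def)
next
  assume "invertible C a"
  then obtain b where "b \<in> hom2 C g f" "a \<bullet> b = id2 C f" "b \<bullet> a = id2 C g"
    using assms(1) by (rule invertibleE)
  then have "inverse_pair (hom_category C X Y) a b"
    using assms(2,3) hom2D[OF assms(1)] hom2D(1-3)[of b g f]
    by (simp add: inverse_pair_def hom_category_simps)
  then show "isomorphism (hom_category C X Y) a"
    by (auto simp: isomorphism_def)
qed

lemma category_functor_precomposition:
  assumes "f \<in> arr C" and "src1 C f = X" and "tgt1 C f = Y"
  shows "category_functor (hom_category C Y Z) (hom_category C X Z)
    (\<lambda>h. f \<sharp>\<^sub>1 h) (\<lambda>a. id2 C f \<sharp>\<^sub>2 a)"
proof (intro category_functor.intro category_functor_axioms.intro category_hom_category)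
  fix a assume "a \<in> Mor (hom_category C Y Z)"
  then have a: "a \<in> cell C" "src1 C (src2 C a) = Y" "tgt1 C (src2 C a) = Z"
    by (simp_all add: hom_category_simps)
  note D = hom2D[OF cell_hom2[OF a(1)]]
  note fa = hom2D[OF hcomp_hom2[OF id2_hom2[OF assms(1)] cell_hom2[OF a(1)]]]
  show "id2 C f \<sharp>\<^sub>2 a \<in> Mor (hom_category C X Z)"
    "Dom (hom_category C X Z) (id2 C f \<sharp>\<^sub>2 a) = f \<sharp>\<^sub>1 Dom (hom_category C Y Z) a"
    "Cod (hom_category C X Z) (id2 C f \<sharp>\<^sub>2 a) = f \<sharp>\<^sub>1 Cod (hom_category C Y Z) a"
    using fa a assms D by (simp_all add: hom_category_simps)
  fix b assume "b \<in> Mor (hom_category C Y Z)"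
    and "Cod (hom_category C Y Z) a = Dom (hom_category C Y Z) b"
  then have b: "b \<in> hom2 C (tgt2 C a) (tgt2 C b)"
    by (simp add: hom_category_simps hom2_def)
  show "id2 C f \<sharp>\<^sub>2 Comp (hom_category C Y Z) a b =
      Comp (hom_category C X Z) (id2 C f \<sharp>\<^sub>2 a) (id2 C f \<sharp>\<^sub>2 b)"
    using whisker_left_vcomp[OF cell_hom2[OF a(1)] b] a assms by (simp add: hom_category_simps)
next
  fix h assume "h \<in> Ob (hom_category C Y Z)"
  then show "f \<sharp>\<^sub>1 h \<in> Ob (hom_category C X Z)"
    "id2 C f \<sharp>\<^sub>2 Ident (hom_category C Y Z) h = Ident (hom_category C X Z) (f \<sharp>\<^sub>1 h)"
    using assms by (simp_all add: hom_category_simps id2_comp1)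
qed

text \<open>The quasi-inverse is precomposition with a pseudo-inverse g. The two natural
  isomorphisms are obtained by whiskering the invertible cells of the pseudo-inverse with the
  varying arrow h, and their naturality is interchange.\<close>

lemma equivalence_functor_precomposition:
  assumes "equi_arrow C f" and X: "src1 C f = X" and Y: "tgt1 C f = Y"
  shows "equivalence_functor (hom_category C Y Z) (hom_category C X Z)
    (\<lambda>h. f \<sharp>\<^sub>1 h) (\<lambda>a. id2 C f \<sharp>\<^sub>2 a)"
proof -
  obtain g a b where f: "f \<in> arr C" and g: "g \<in> arr C" "src1 C g = Y" "tgt1 C g = X"
    and a: "a \<in> hom2 C (f \<sharp>\<^sub>1 g) (id1 C X)" "invertible C a"
    and b: "b \<in> hom2 C (g \<sharp>\<^sub>1 f) (id1 C Y)" "invertible C b"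
    using assms unfolding equi_arrow_def hom1_def by auto
  \<comment> \<open>An equivalence asks for a natural isomorphism out of the identity functor,
    whereas \<open>b\<close> points into the identity arrow, so its inverse is taken.\<close>
  define c where "c = vinv C b"
  have c: "c \<in> hom2 C (id1 C Y) (g \<sharp>\<^sub>1 f)" "invertible C c"
    using vinv(1)[OF b(2,1)] invertible_vinv[OF b(2,1)] by (auto simp: c_def)
  have XY: "X \<in> obj C" "Y \<in> obj C" using f X Y by auto
  have "natural_isomorphism (hom_category C Y Z) (hom_category C Y Z) id id
      ((\<lambda>h. g \<sharp>\<^sub>1 h) \<circ> (\<lambda>h. f \<sharp>\<^sub>1 h)) ((\<lambda>k. id2 C g \<sharp>\<^sub>2 k) \<circ> (\<lambda>k. id2 C f \<sharp>\<^sub>2 k))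
      (\<lambda>h. c \<sharp>\<^sub>2 id2 C h)"
    unfolding natural_isomorphism_def
  proof (intro conjI ballI)
    fix h assume "h \<in> Ob (hom_category C Y Z)"
    then have h: "h \<in> arr C" "src1 C h = Y" "tgt1 C h = Z" by (simp_all add: hom_category_simps)
    have 1: "c \<sharp>\<^sub>2 id2 C h \<in> hom2 C h (g \<sharp>\<^sub>1 (f \<sharp>\<^sub>1 h))"
      using hcomp_hom2[OF c(1) id2_hom2[OF h(1)]] h f g X Y XY by (simp add: comp1_assoc)
    have "invertible C (c \<sharp>\<^sub>2 id2 C h)"
      using invertible_hcomp[OF c(2,1) invertible_id2[OF h(1)] id2_hom2[OF h(1)]] h XY by simp
    then show "isomorphism (hom_category C Y Z) (c \<sharp>\<^sub>2 id2 C h)"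
      using isomorphism_hom_category_iff[OF 1] h by simp
    show "Dom (hom_category C Y Z) (c \<sharp>\<^sub>2 id2 C h) = id h"
      "Cod (hom_category C Y Z) (c \<sharp>\<^sub>2 id2 C h) = ((\<lambda>h. g \<sharp>\<^sub>1 h) \<circ> (\<lambda>h. f \<sharp>\<^sub>1 h)) h"
      using hom2D[OF 1] by (simp_all add: hom_category_simps)
  next
    fix k assume "k \<in> Mor (hom_category C Y Z)"
    then have kc: "k \<in> cell C" and ks: "src1 C (src2 C k) = Y"
      by (simp_all add: hom_category_simps)
    note k = cell_hom2[OF kc]
    \<comment> \<open>The naturality square consists of the two factorizations of the single
      horizontal composite of \<open>c\<close> and \<open>k\<close>; since \<open>c\<close> starts
      at an identity arrow, whiskering \<open>k\<close> with that arrow gives back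
      \<open>k\<close>.\<close>
    have "k \<bullet> (c \<sharp>\<^sub>2 id2 C (tgt2 C k)) = c \<sharp>\<^sub>2 k"
      using hcomp_eq_right_left[OF c(1) k] ks XY obj2_hcomp[OF k ks] by (simp add: obj2_def)
    also have "\<dots> = (c \<sharp>\<^sub>2 id2 C (src2 C k)) \<bullet> (id2 C (g \<sharp>\<^sub>1 f) \<sharp>\<^sub>2 k)"
      using hcomp_eq_left_right[OF c(1) k] ks XY by simp
    also have "id2 C (g \<sharp>\<^sub>1 f) \<sharp>\<^sub>2 k = id2 C g \<sharp>\<^sub>2 (id2 C f \<sharp>\<^sub>2 k)"
      using hcomp_assoc[OF id2_hom2[OF g(1)] id2_hom2[OF f] k] g f X Y ks by (simp add: id2_comp1)
    finally show "Comp (hom_category C Y Z) (id k)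
        (c \<sharp>\<^sub>2 id2 C (Cod (hom_category C Y Z) k)) =
      Comp (hom_category C Y Z) (c \<sharp>\<^sub>2 id2 C (Dom (hom_category C Y Z) k))
        (((\<lambda>k. id2 C g \<sharp>\<^sub>2 k) \<circ> (\<lambda>k. id2 C f \<sharp>\<^sub>2 k)) k)"
      by (simp add: hom_category_simps)
  qed
  moreover have "natural_isomorphism (hom_category C X Z) (hom_category C X Z)
      ((\<lambda>h. f \<sharp>\<^sub>1 h) \<circ> (\<lambda>h. g \<sharp>\<^sub>1 h)) ((\<lambda>k. id2 C f \<sharp>\<^sub>2 k) \<circ> (\<lambda>k. id2 C g \<sharp>\<^sub>2 k)) id id
      (\<lambda>h. a \<sharp>\<^sub>2 id2 C h)"
    unfolding natural_isomorphism_def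
  proof (intro conjI ballI)
    fix h assume "h \<in> Ob (hom_category C X Z)"
    then have h: "h \<in> arr C" "src1 C h = X" "tgt1 C h = Z" by (simp_all add: hom_category_simps)
    have 1: "a \<sharp>\<^sub>2 id2 C h \<in> hom2 C (f \<sharp>\<^sub>1 (g \<sharp>\<^sub>1 h)) h"
      using hcomp_hom2[OF a(1) id2_hom2[OF h(1)]] h f g X Y XY by (simp add: comp1_assoc)
    have "invertible C (a \<sharp>\<^sub>2 id2 C h)"
      using invertible_hcomp[OF a(2,1) invertible_id2[OF h(1)] id2_hom2[OF h(1)]] h XY f g X Y
      by simp
    then show "isomorphism (hom_category C X Z) (a \<sharp>\<^sub>2 id2 C h)"
      using isomorphism_hom_category_iff[OF 1] h f g X Y by simp
    show "Dom (hom_category C X Z) (a \<sharp>\<^sub>2 id2 C h) = ((\<lambda>h. f \<sharp>\<^sub>1 h) \<circ> (\<lambda>h. g \<sharp>\<^sub>1 h)) h"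
      "Cod (hom_category C X Z) (a \<sharp>\<^sub>2 id2 C h) = id h"
      using hom2D[OF 1] by (simp_all add: hom_category_simps)
  next
    fix k assume "k \<in> Mor (hom_category C X Z)"
    then have kc: "k \<in> cell C" and ks: "src1 C (src2 C k) = X"
      by (simp_all add: hom_category_simps)
    note k = cell_hom2[OF kc]
    have "id2 C f \<sharp>\<^sub>2 (id2 C g \<sharp>\<^sub>2 k) = id2 C (f \<sharp>\<^sub>1 g) \<sharp>\<^sub>2 k"
      using hcomp_assoc[OF id2_hom2[OF f] id2_hom2[OF g(1)] k] g f X Y ks by (simp add: id2_comp1)
    then have "(id2 C f \<sharp>\<^sub>2 (id2 C g \<sharp>\<^sub>2 k)) \<bullet> (a \<sharp>\<^sub>2 id2 C (tgt2 C k)) = a \<sharp>\<^sub>2 k"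
      using hcomp_eq_right_left[OF a(1) k] f g X Y ks XY by simp
    also have "\<dots> = (a \<sharp>\<^sub>2 id2 C (src2 C k)) \<bullet> k"
      using hcomp_eq_left_right[OF a(1) k] f g X Y ks XY obj2_hcomp[OF k ks]
      by (simp add: obj2_def)
    finally show "Comp (hom_category C X Z)
        (((\<lambda>k. id2 C f \<sharp>\<^sub>2 k) \<circ> (\<lambda>k. id2 C g \<sharp>\<^sub>2 k)) k)
        (a \<sharp>\<^sub>2 id2 C (Cod (hom_category C X Z) k)) =
      Comp (hom_category C X Z) (a \<sharp>\<^sub>2 id2 C (Dom (hom_category C X Z) k)) (id k)"
      by (simp add: hom_category_simps)
  qed
  ultimately show ?thesis
    unfolding equivalence_functor_def
    using category_functor_precomposition[OF f X Y] category_functor_precomposition[OF g]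
    by blast
qed

text \<open>Bijectivity on isomorphisms, restated in the exact shape of the descriptions in
  \<open>K_lam\<close> and \<open>K_rho\<close>. The end objects of m need no hypothesis of their
  own: they are those of the image of h under the functor.\<close>

lemma equivalence_functor_ex1_hom2:
  assumes eqv: "equivalence_functor (hom_category C X Y) (hom_category C X' Y') F1 F2"
    and h: "h \<in> hom1 C X Y" and h': "h' \<in> hom1 C X Y"
    and m: "m \<in> hom2 C (F1 h) (F1 h')" "invertible C m"
  shows "\<exists>!k. k \<in> hom2 C h h' \<and> invertible C k \<and> F2 k = m"
proof -
  interpret F: category_functor "hom_category C X Y" "hom_category C X' Y'" F1 F2
    using eqv by (simp add: equivalence_functor_def)
  have hO: "h \<in> Ob (hom_category C X Y)" "h' \<in> Ob (hom_category C X Y)"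
    using h h' by (auto simp: hom_category_simps hom1_def)
  have "isomorphism (hom_category C X' Y') m"
    using isomorphism_hom_category_iff[OF m(1)] m(2) F.F0_closed[OF hO(1)]
    by (simp add: hom_category_simps)
  then have ex1: "\<exists>!k. k \<in> Mor (hom_category C X Y) \<and> Dom (hom_category C X Y) k = h \<and>
      Cod (hom_category C X Y) k = h' \<and> isomorphism (hom_category C X Y) k \<and> F2 k = m"
    using equivalence_functor_ex1_isomorphism[OF eqv hO] hom2D[OF m(1)]
    by (simp add: hom_category_simps)
  have "k \<in> Mor (hom_category C X Y) \<and> Dom (hom_category C X Y) k = h \<and>
      Cod (hom_category C X Y) k = h' \<and> isomorphism (hom_category C X Y) k \<and> F2 k = m
    \<longleftrightarrow> k \<in> hom2 C h h' \<and> invertible C k \<and> F2 k = m" for k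
    using isomorphism_hom_category_iff[of k h h' X Y] h
    by (auto simp: hom_category_simps hom1_def hom2_def)
  then show ?thesis using ex1 by simp
qed

lemma whisker_left_ex1:
  assumes f: "equi_arrow C f" "tgt1 C f = Y" and h: "h \<in> hom1 C Y Z" and h': "h' \<in> hom1 C Y Z"
    and m: "m \<in> hom2 C (f \<sharp>\<^sub>1 h) (f \<sharp>\<^sub>1 h')" "invertible C m"
  shows "\<exists>!k. k \<in> hom2 C h h' \<and> invertible C k \<and> id2 C f \<sharp>\<^sub>2 k = m"
  using equivalence_functor_ex1_hom2[OF equivalence_functor_precomposition[OF f(1) refl f(2)]
      h h' m] .

text \<open>The first of the next two lemmas slides \<open>k\<close> past \<open>a\<close> and the second slides \<open>k\<close> past \<open>b\<close>;
  then \<open>c'\<close> cancels against \<open>c\<close>.\<close>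

lemma whisker_vcomp_slide_left:
  assumes a: "a \<in> hom2 C p p'" and k: "k \<in> hom2 C g g'" and m: "m \<in> hom2 C g' g''"
    and pg: "tgt1 C p = src1 C g"
    and pm: "id2 C p \<sharp>\<^sub>2 m = (a \<sharp>\<^sub>2 id2 C g') \<bullet> c" and p'k: "id2 C p' \<sharp>\<^sub>2 k = b \<bullet> c'"
    and c: "c \<in> hom2 C (p' \<sharp>\<^sub>1 g') s" and b: "b \<in> hom2 C (p' \<sharp>\<^sub>1 g) s"
    and c': "c' \<in> hom2 C s (p' \<sharp>\<^sub>1 g')" and c'c: "c' \<bullet> c = id2 C s"
  shows "id2 C p \<sharp>\<^sub>2 (k \<bullet> m) = (a \<sharp>\<^sub>2 id2 C g) \<bullet> b"
proof -
  note D = hom2D[OF a] hom2D[OF k]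
  have pk: "id2 C p \<sharp>\<^sub>2 k \<in> hom2 C (p \<sharp>\<^sub>1 g) (p \<sharp>\<^sub>1 g')"
    and ag: "a \<sharp>\<^sub>2 id2 C g \<in> hom2 C (p \<sharp>\<^sub>1 g) (p' \<sharp>\<^sub>1 g)"
    and ag': "a \<sharp>\<^sub>2 id2 C g' \<in> hom2 C (p \<sharp>\<^sub>1 g') (p' \<sharp>\<^sub>1 g')"
    using D pg by (simp_all add: whisker_left_hom2[OF k] whisker_right_hom2[OF a])
  have "id2 C p \<sharp>\<^sub>2 (k \<bullet> m) = (id2 C p \<sharp>\<^sub>2 k) \<bullet> ((a \<sharp>\<^sub>2 id2 C g') \<bullet> c)"
    using whisker_left_vcomp[OF k m] D pg pm by simp
  \<comment> \<open>The two whiskered copies are one factorization of the horizontal composite of a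
    and k. The next step reads that composite in the other order, where k is whiskered by p' instead
    of p and the hypothesis \<open>p'k\<close> applies.\<close>
  also have "\<dots> = (a \<sharp>\<^sub>2 k) \<bullet> c"
    using vcomp_assoc[OF pk ag' c] hcomp_eq_right_left[OF a k pg] by simp
  also have "\<dots> = (a \<sharp>\<^sub>2 id2 C g) \<bullet> (b \<bullet> c') \<bullet> c"
    using hcomp_eq_left_right[OF a k pg] p'k by simp
  also have "\<dots> = (a \<sharp>\<^sub>2 id2 C g) \<bullet> b"
    using vcomp_assoc[OF ag vcomp_hom2[OF b c'] c] vcomp_assoc[OF b c' c] c'c vcomp_id2[OF b]
    by simp
  finally show ?thesis .
qed

lemma whisker_vcomp_slide_right:
  assumes b: "b \<in> hom2 C p' p" and k: "k \<in> hom2 C g g'" and m: "m \<in> hom2 C h g"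
    and pg: "tgt1 C p = src1 C g"
    and pm: "id2 C p \<sharp>\<^sub>2 m = c \<bullet> (b \<sharp>\<^sub>2 id2 C g)" and p'k: "id2 C p' \<sharp>\<^sub>2 k = c' \<bullet> a"
    and c: "c \<in> hom2 C s (p' \<sharp>\<^sub>1 g)" and a: "a \<in> hom2 C s (p' \<sharp>\<^sub>1 g')"
    and c': "c' \<in> hom2 C (p' \<sharp>\<^sub>1 g) s" and cc': "c \<bullet> c' = id2 C s"
  shows "id2 C p \<sharp>\<^sub>2 (m \<bullet> k) = a \<bullet> (b \<sharp>\<^sub>2 id2 C g')"
proof -
  note D = hom2D[OF b] hom2D[OF k] hom2D[OF m]
  have p'g: "tgt1 C p' = src1 C g" using D pg by simp
  have pk: "id2 C p \<sharp>\<^sub>2 k \<in> hom2 C (p \<sharp>\<^sub>1 g) (p \<sharp>\<^sub>1 g')"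
    and bg: "b \<sharp>\<^sub>2 id2 C g \<in> hom2 C (p' \<sharp>\<^sub>1 g) (p \<sharp>\<^sub>1 g)"
    and bg': "b \<sharp>\<^sub>2 id2 C g' \<in> hom2 C (p' \<sharp>\<^sub>1 g') (p \<sharp>\<^sub>1 g')"
    using D pg by (simp_all add: whisker_left_hom2[OF k] whisker_right_hom2[OF b])
  have "id2 C p \<sharp>\<^sub>2 (m \<bullet> k) = c \<bullet> (b \<sharp>\<^sub>2 id2 C g) \<bullet> (id2 C p \<sharp>\<^sub>2 k)"
    using whisker_left_vcomp[OF m k] D pg pm by simp
  also have "\<dots> = c \<bullet> (b \<sharp>\<^sub>2 k)"
    using vcomp_assoc[OF c bg pk] hcomp_eq_left_right[OF b k p'g] by simp
  \<comment> \<open>Here the composite of b and k is re-read with k first, so that k is whiskered by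
    p' and \<open>p'k\<close> puts c' directly after c.\<close>
  also have "\<dots> = c \<bullet> (c' \<bullet> a \<bullet> (b \<sharp>\<^sub>2 id2 C g'))"
    using hcomp_eq_right_left[OF b k p'g] p'k by simp
  also have "\<dots> = c \<bullet> c' \<bullet> (a \<bullet> (b \<sharp>\<^sub>2 id2 C g'))"
    using vcomp_assoc[OF c' a bg'] vcomp_assoc[OF c c' vcomp_hom2[OF a bg']] by simp
  also have "\<dots> = a \<bullet> (b \<sharp>\<^sub>2 id2 C g')"
    using cc' id2_vcomp[OF vcomp_hom2[OF a bg']] by simp
  finally show ?thesis .
qed

end

section \<open>Tensor products\<close>

context semi_monoidal_2category
begin

text \<open>A strict 2-functor is three ordinary functors: on arrows under composition, and on
  2-cells under vertical and horizontal composition. Each tensor law below is an axiom of one of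
  them, evaluated at pairs.\<close>

sublocale tensor: strict_2functor "product_2cat C C" C
  "\<lambda>(X, Y). X \<otimes>\<^sub>0 Y" "\<lambda>(f, g). f \<otimes>\<^sub>1 g" "\<lambda>(a, b). a \<otimes>\<^sub>2 b"
  by (rule tensor_2functor)

sublocale tensorA: category_functor "arrow_category (product_2cat C C)" "arrow_category C"
  "\<lambda>(X, Y). X \<otimes>\<^sub>0 Y" "\<lambda>(f, g). f \<otimes>\<^sub>1 g"
  by (rule tensor.functor_arrow)

sublocale tensorV: category_functor "vertical_category (product_2cat C C)" "vertical_category C"
  "\<lambda>(f, g). f \<otimes>\<^sub>1 g" "\<lambda>(a, b). a \<otimes>\<^sub>2 b"
  by (rule tensor.functor_vertical)

sublocale tensorH: category_functor "horizontal_category (product_2cat C C)"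
  "horizontal_category C" "\<lambda>(X, Y). X \<otimes>\<^sub>0 Y" "\<lambda>(a, b). a \<otimes>\<^sub>2 b"
  by (rule tensor.functor_horizontal)

section \<open>Tensor laws on objects, arrows and 2-cells\<close>

lemma tensor_obj [simp]: "X \<in> obj C \<Longrightarrow> Y \<in> obj C \<Longrightarrow> X \<otimes>\<^sub>0 Y \<in> obj C"
  using tensorA.F0_closed[of "(X, Y)"] by (simp add: arrow_category_def product_2cat_def)

lemma tensor_arr [simp]:
  assumes "f \<in> arr C" and "g \<in> arr C"
  shows "f \<otimes>\<^sub>1 g \<in> arr C" "src1 C (f \<otimes>\<^sub>1 g) = src1 C f \<otimes>\<^sub>0 src1 C g"
    "tgt1 C (f \<otimes>\<^sub>1 g) = tgt1 C f \<otimes>\<^sub>0 tgt1 C g"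
  using assms tensorA.F1_closed[of "(f, g)"] tensorA.F1_Dom[of "(f, g)"] tensorA.F1_Cod[of "(f, g)"]
  by (simp_all add: arrow_category_def product_2cat_def)

lemma id1_tensor: "X \<in> obj C \<Longrightarrow> Y \<in> obj C \<Longrightarrow> id1 C (X \<otimes>\<^sub>0 Y) = id1 C X \<otimes>\<^sub>1 id1 C Y"
  using tensorA.F1_Ident[of "(X, Y)"] by (simp add: arrow_category_def product_2cat_def)

lemma tensor_comp1:
  assumes "f \<in> arr C" and "f' \<in> arr C" and "g \<in> arr C" and "g' \<in> arr C"
    and "tgt1 C f = src1 C f'" and "tgt1 C g = src1 C g'"
  shows "(f \<otimes>\<^sub>1 g) \<sharp>\<^sub>1 (f' \<otimes>\<^sub>1 g') = (f \<sharp>\<^sub>1 f') \<otimes>\<^sub>1 (g \<sharp>\<^sub>1 g')"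
  using assms tensorA.F1_Comp[of "(f, g)" "(f', g')"]
  by (simp add: arrow_category_def product_2cat_def)

lemma id2_tensor: "f \<in> arr C \<Longrightarrow> g \<in> arr C \<Longrightarrow> id2 C (f \<otimes>\<^sub>1 g) = id2 C f \<otimes>\<^sub>2 id2 C g"
  using tensorV.F1_Ident[of "(f, g)"] by (simp add: vertical_category_def product_2cat_def)

lemma obj2_tensor: "X \<in> obj C \<Longrightarrow> Y \<in> obj C \<Longrightarrow> obj2 C (X \<otimes>\<^sub>0 Y) = obj2 C X \<otimes>\<^sub>2 obj2 C Y"
  by (simp add: obj2_def id1_tensor id2_tensor)

lemma tensor_hom2:
  assumes "a \<in> hom2 C f g" and "b \<in> hom2 C f' g'"
  shows "a \<otimes>\<^sub>2 b \<in> hom2 C (f \<otimes>\<^sub>1 f') (g \<otimes>\<^sub>1 g')"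
  using assms tensorV.F1_closed[of "(a, b)"] tensorV.F1_Dom[of "(a, b)"] tensorV.F1_Cod[of "(a, b)"]
  by (simp add: vertical_category_def product_2cat_def hom2_def)

lemma tensor_cell [simp]: "a \<in> cell C \<Longrightarrow> b \<in> cell C \<Longrightarrow> a \<otimes>\<^sub>2 b \<in> cell C"
  using hom2D(1)[OF tensor_hom2[OF cell_hom2 cell_hom2]] .

lemma tensor_vcomp:
  assumes "a \<in> hom2 C f g" and "b \<in> hom2 C g h" and "a' \<in> hom2 C f' g'" and "b' \<in> hom2 C g' h'"
  shows "(a \<bullet> b) \<otimes>\<^sub>2 (a' \<bullet> b') = (a \<otimes>\<^sub>2 a') \<bullet> (b \<otimes>\<^sub>2 b')"
  using assms tensorV.F1_Comp[of "(a, a')" "(b, b')"]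
  by (simp add: vertical_category_def product_2cat_def hom2_def)

lemma tensor_hcomp:
  assumes "a \<in> hom2 C f g" and "b \<in> hom2 C h k" and "a' \<in> hom2 C f' g'" and "b' \<in> hom2 C h' k'"
    and "tgt1 C f = src1 C h" and "tgt1 C f' = src1 C h'"
  shows "(a \<sharp>\<^sub>2 b) \<otimes>\<^sub>2 (a' \<sharp>\<^sub>2 b') = (a \<otimes>\<^sub>2 a') \<sharp>\<^sub>2 (b \<otimes>\<^sub>2 b')"
  using assms tensorH.F1_Comp[of "(a, a')" "(b, b')"]
  by (simp add: horizontal_category_def product_2cat_def hom2_def)

text \<open>Writing the 2-cell of an object as its own vertical square is what makes tensoring with
  that object distribute over vertical composites.\<close>

lemma obj2_vcomp_obj2: "X \<in> obj C \<Longrightarrow> obj2 C X \<bullet> obj2 C X = obj2 C X"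
  using id2_vcomp[OF obj2_hom2[of X]] by (simp add: obj2_def)

lemma vcomp_tensor_obj2:
  assumes "a \<in> hom2 C f g" and "b \<in> hom2 C g h" and Z: "Z \<in> obj C"
  shows "(a \<bullet> b) \<otimes>\<^sub>2 obj2 C Z = (a \<otimes>\<^sub>2 obj2 C Z) \<bullet> (b \<otimes>\<^sub>2 obj2 C Z)"
  using tensor_vcomp[OF assms(1,2) obj2_hom2[OF Z] obj2_hom2[OF Z]] Z
  by (simp add: obj2_vcomp_obj2)

lemma obj2_tensor_vcomp:
  assumes "a \<in> hom2 C f g" and "b \<in> hom2 C g h" and Z: "Z \<in> obj C"
  shows "obj2 C Z \<otimes>\<^sub>2 (a \<bullet> b) = (obj2 C Z \<otimes>\<^sub>2 a) \<bullet> (obj2 C Z \<otimes>\<^sub>2 b)"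
  using tensor_vcomp[OF obj2_hom2[OF Z] obj2_hom2[OF Z] assms(1,2)] Z
  by (simp add: obj2_vcomp_obj2)

lemma hcomp_tensor_obj2:
  assumes "a \<in> hom2 C f g" and "b \<in> hom2 C h k" and "tgt1 C f = src1 C h" and Z: "Z \<in> obj C"
  shows "(a \<sharp>\<^sub>2 b) \<otimes>\<^sub>2 obj2 C Z = (a \<otimes>\<^sub>2 obj2 C Z) \<sharp>\<^sub>2 (b \<otimes>\<^sub>2 obj2 C Z)"
  using tensor_hcomp[OF assms(1,2) obj2_hom2[OF Z] obj2_hom2[OF Z] assms(3)] Z
    obj2_hcomp[OF obj2_hom2[OF Z]]
  by simp

lemma obj2_tensor_hcomp:
  assumes "a \<in> hom2 C f g" and "b \<in> hom2 C h k" and "tgt1 C f = src1 C h" and Z: "Z \<in> obj C"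
  shows "obj2 C Z \<otimes>\<^sub>2 (a \<sharp>\<^sub>2 b) = (obj2 C Z \<otimes>\<^sub>2 a) \<sharp>\<^sub>2 (obj2 C Z \<otimes>\<^sub>2 b)"
  using tensor_hcomp[OF obj2_hom2[OF Z] obj2_hom2[OF Z] assms(1,2) _ assms(3)] Z
    obj2_hcomp[OF obj2_hom2[OF Z]]
  by simp

text \<open>Both composites equal the tensor of f and g by functoriality. With f = \<rho>_X and g =
  \<lambda>_Y this is the equality of arrows that makes the defining composite of \<open>K\<close>
  meaningful.\<close>

lemma comp1_slide:
  assumes "f \<in> arr C" and "src1 C f = A" and "tgt1 C f = A'"
    and "g \<in> arr C" and "src1 C g = B" and "tgt1 C g = B'"
  shows "(f \<otimes>\<^sub>1 id1 C B) \<sharp>\<^sub>1 (id1 C A' \<otimes>\<^sub>1 g) = (id1 C A \<otimes>\<^sub>1 g) \<sharp>\<^sub>1 (f \<otimes>\<^sub>1 id1 C B')"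
  using assms by (auto simp: tensor_comp1)

text \<open>Both sides are the tensor of a and b. Taking one of them to be an identity 2-cell moves
  a 2-cell past an arrow on the other tensor factor, and the object tensored to the moving cell
  changes from an end object of that arrow to the opposite one.\<close>

lemma hcomp_slide:
  assumes a: "a \<in> hom2 C f f'" and A: "src1 C f = A" "tgt1 C f = A'"
    and b: "b \<in> hom2 C g g'" and B: "src1 C g = B" "tgt1 C g = B'"
  shows "(a \<otimes>\<^sub>2 obj2 C B) \<sharp>\<^sub>2 (obj2 C A' \<otimes>\<^sub>2 b) = (obj2 C A \<otimes>\<^sub>2 b) \<sharp>\<^sub>2 (a \<otimes>\<^sub>2 obj2 C B')"
proof -
  have o: "A \<in> obj C" "A' \<in> obj C" "B \<in> obj C" "B' \<in> obj C"
    using hom2D(4)[OF a] hom2D(4)[OF b] A B by auto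
  have "(a \<otimes>\<^sub>2 obj2 C B) \<sharp>\<^sub>2 (obj2 C A' \<otimes>\<^sub>2 b) = a \<otimes>\<^sub>2 b"
    using tensor_hcomp[OF a obj2_hom2[OF o(2)] obj2_hom2[OF o(3)] b] o A B
    by (simp add: hcomp_obj2[OF a] obj2_hcomp[OF b])
  also have "\<dots> = (obj2 C A \<otimes>\<^sub>2 b) \<sharp>\<^sub>2 (a \<otimes>\<^sub>2 obj2 C B')"
    using tensor_hcomp[OF obj2_hom2[OF o(1)] a b obj2_hom2[OF o(4)]] o A B
    by (simp add: obj2_hcomp[OF a] hcomp_obj2[OF b])
  finally show ?thesis .
qed

lemma invertible_tensor:
  assumes a: "invertible C a" "a \<in> hom2 C f g" and b: "invertible C b" "b \<in> hom2 C f' g'"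
  shows "invertible C (a \<otimes>\<^sub>2 b)"
proof (rule invertibleI)
  note va = vinv[OF a] and vb = vinv[OF b]
  note arrs = hom2D(4,5)[OF a(2)] hom2D(4,5)[OF b(2)]
  show "a \<otimes>\<^sub>2 b \<in> hom2 C (f \<otimes>\<^sub>1 f') (g \<otimes>\<^sub>1 g')"
    by (rule tensor_hom2[OF a(2) b(2)])
  show "vinv C a \<otimes>\<^sub>2 vinv C b \<in> hom2 C (g \<otimes>\<^sub>1 g') (f \<otimes>\<^sub>1 f')"
    by (rule tensor_hom2[OF va(1) vb(1)])
  show "(a \<otimes>\<^sub>2 b) \<bullet> (vinv C a \<otimes>\<^sub>2 vinv C b) = id2 C (f \<otimes>\<^sub>1 f')"
    using tensor_vcomp[OF a(2) va(1) b(2) vb(1)] va vb arrs by (simp add: id2_tensor)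
  show "(vinv C a \<otimes>\<^sub>2 vinv C b) \<bullet> (a \<otimes>\<^sub>2 b) = id2 C (g \<otimes>\<^sub>1 g')"
    using tensor_vcomp[OF va(1) a(2) vb(1) b(2)] va vb arrs by (simp add: id2_tensor)
qed

lemma equi_arrow_id1: "X \<in> obj C \<Longrightarrow> equi_arrow C (id1 C X)"
  unfolding equi_arrow_def hom1_def
  using obj2_hom2[of X] invertible_obj2[of X] by (auto intro!: exI[of _ "id1 C X"] bexI[of _ "obj2 C X"])

text \<open>Pseudo-inverses are tensored factor by factor, and so are the invertible 2-cells that
  witness them. The use is that X\<alpha>Y is an equi-arrow, since \<alpha> and identity arrows
  are.\<close>

lemma equi_arrow_tensor:
  assumes "equi_arrow C f" and "equi_arrow C g"
  shows "equi_arrow C (f \<otimes>\<^sub>1 g)"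
proof -
  obtain f' a b where f: "f \<in> arr C" and f': "f' \<in> arr C" "src1 C f' = tgt1 C f" "tgt1 C f' = src1 C f"
    and a: "a \<in> hom2 C (f \<sharp>\<^sub>1 f') (id1 C (src1 C f))" "invertible C a"
    and b: "b \<in> hom2 C (f' \<sharp>\<^sub>1 f) (id1 C (tgt1 C f))" "invertible C b"
    using assms(1) unfolding equi_arrow_def hom1_def by auto
  obtain g' c d where g: "g \<in> arr C" and g': "g' \<in> arr C" "src1 C g' = tgt1 C g" "tgt1 C g' = src1 C g"
    and c: "c \<in> hom2 C (g \<sharp>\<^sub>1 g') (id1 C (src1 C g))" "invertible C c"
    and d: "d \<in> hom2 C (g' \<sharp>\<^sub>1 g) (id1 C (tgt1 C g))" "invertible C d"
    using assms(2) unfolding equi_arrow_def hom1_def by auto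
  show ?thesis
    unfolding equi_arrow_def
  proof (intro conjI bexI)
    show "invertible C (a \<otimes>\<^sub>2 c)" "invertible C (b \<otimes>\<^sub>2 d)"
      using a b c d by (blast intro: invertible_tensor)+
    show "a \<otimes>\<^sub>2 c \<in> hom2 C ((f \<otimes>\<^sub>1 g) \<sharp>\<^sub>1 (f' \<otimes>\<^sub>1 g')) (id1 C (src1 C (f \<otimes>\<^sub>1 g)))"
      using tensor_hom2[OF a(1) c(1)] f f' g g' by (simp add: tensor_comp1 id1_tensor)
    show "b \<otimes>\<^sub>2 d \<in> hom2 C ((f' \<otimes>\<^sub>1 g') \<sharp>\<^sub>1 (f \<otimes>\<^sub>1 g)) (id1 C (tgt1 C (f \<otimes>\<^sub>1 g)))"
      using tensor_hom2[OF b(1) d(1)] f f' g g' by (simp add: tensor_comp1 id1_tensor)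
  qed (use f f' g g' in \<open>simp_all add: hom1_def\<close>)
qed

end

section \<open>Unit constraints\<close>

locale unit_constraints = semi_monoidal_2category C
  for C :: "('o, 'a, 'c) semi_monoidal_2cat" (structure) +
  fixes I :: 'o and \<alpha> :: 'a and lam rho :: "'o \<Rightarrow> 'a" and L R :: "'o \<Rightarrow> 'c"
  assumes unit_object: "unit_object C I \<alpha>"
    and left_constraint: "left_constraint C I \<alpha> lam L"
    and right_constraint: "right_constraint C I \<alpha> rho R"
begin

abbreviation K where "K \<equiv> K_cell C \<alpha> lam L rho R"
abbreviation Kl where "Kl \<equiv> K_lam C I lam L"
abbreviation Kr where "Kr \<equiv> K_rho C I rho R"

lemma unit_simps [simp]:
  "I \<in> obj C" "\<alpha> \<in> arr C" "src1 C \<alpha> = I \<otimes>\<^sub>0 I" "tgt1 C \<alpha> = I" "equi_arrow C \<alpha>"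
  using unit_object by (simp_all add: unit_object_def cancellable_def hom1_def)

lemma constraint_simps [simp]:
  assumes "X \<in> obj C"
  shows "lam X \<in> arr C" "src1 C (lam X) = I \<otimes>\<^sub>0 X" "tgt1 C (lam X) = X"
    "rho X \<in> arr C" "src1 C (rho X) = X \<otimes>\<^sub>0 I" "tgt1 C (rho X) = X"
  using assms left_constraint right_constraint
  by (simp_all add: left_constraint_def right_constraint_def hom1_def)

lemma L_cell:
  assumes "X \<in> obj C"
  shows "L X \<in> hom2 C (id1 C I \<otimes>\<^sub>1 lam X) (\<alpha> \<otimes>\<^sub>1 id1 C X)" "invertible C (L X)"
  using assms left_constraint by (simp_all add: left_constraint_def)

lemma R_cell:
  assumes "X \<in> obj C"
  shows "R X \<in> hom2 C (id1 C X \<otimes>\<^sub>1 \<alpha>) (rho X \<otimes>\<^sub>1 id1 C I)" "invertible C (R X)"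
  using assms right_constraint by (simp_all add: right_constraint_def)

lemmas vinv_L = vinv[OF L_cell(2,1)] and vinv_R = vinv[OF R_cell(2,1)]

section \<open>Existence and uniqueness of \<open>K\<close>, \<open>Kl\<close> and
  \<open>Kr\<close>\<close>

lemma R_tensor_hom2:
  assumes "X \<in> obj C" and "Y \<in> obj C"
  shows "R X \<otimes>\<^sub>2 obj2 C Y \<in>
    hom2 C (id1 C X \<otimes>\<^sub>1 \<alpha> \<otimes>\<^sub>1 id1 C Y) (rho X \<otimes>\<^sub>1 id1 C I \<otimes>\<^sub>1 id1 C Y)"
  using assms by (intro tensor_hom2 R_cell obj2_hom2)

lemma tensor_L_hom2:
  assumes "X \<in> obj C" and "Y \<in> obj C"
  shows "obj2 C X \<otimes>\<^sub>2 L Y \<in>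
    hom2 C (id1 C X \<otimes>\<^sub>1 (id1 C I \<otimes>\<^sub>1 lam Y)) (id1 C X \<otimes>\<^sub>1 (\<alpha> \<otimes>\<^sub>1 id1 C Y))"
  using assms by (intro tensor_hom2 L_cell obj2_hom2)

lemma R_whisker_hom2:
  assumes "X \<in> obj C" and "Y \<in> obj C"
  shows "(R X \<otimes>\<^sub>2 obj2 C Y) \<sharp>\<^sub>2 id2 C (id1 C X \<otimes>\<^sub>1 lam Y) \<in>
    hom2 C ((id1 C X \<otimes>\<^sub>1 \<alpha> \<otimes>\<^sub>1 id1 C Y) \<sharp>\<^sub>1 (id1 C X \<otimes>\<^sub>1 lam Y))
      ((rho X \<otimes>\<^sub>1 id1 C I \<otimes>\<^sub>1 id1 C Y) \<sharp>\<^sub>1 (id1 C X \<otimes>\<^sub>1 lam Y))"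
  using assms by (intro whisker_right_hom2[OF R_tensor_hom2]) (simp_all add: tensor0_assoc)

lemma rho_lam_slide:
  assumes "X \<in> obj C" and "Y \<in> obj C"
  shows "(rho X \<otimes>\<^sub>1 id1 C I \<otimes>\<^sub>1 id1 C Y) \<sharp>\<^sub>1 (id1 C X \<otimes>\<^sub>1 lam Y) =
      (id1 C X \<otimes>\<^sub>1 (id1 C I \<otimes>\<^sub>1 lam Y)) \<sharp>\<^sub>1 (rho X \<otimes>\<^sub>1 id1 C Y)"
  using comp1_slide[of "rho X" "X \<otimes>\<^sub>0 I" X "lam Y" "I \<otimes>\<^sub>0 Y" Y] assms
  by (simp add: id1_tensor tensor1_assoc)

text \<open>Whiskering gives the source in the order with \<lambda>_Y first; it is recorded here in
  the slid order, so that the cell composes with the target of \<open>R_whisker_hom2\<close> without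
  further rewriting.\<close>

lemma L_whisker_hom2:
  assumes "X \<in> obj C" and "Y \<in> obj C"
  shows "(obj2 C X \<otimes>\<^sub>2 L Y) \<sharp>\<^sub>2 id2 C (rho X \<otimes>\<^sub>1 id1 C Y) \<in>
    hom2 C ((rho X \<otimes>\<^sub>1 id1 C I \<otimes>\<^sub>1 id1 C Y) \<sharp>\<^sub>1 (id1 C X \<otimes>\<^sub>1 lam Y))
      ((id1 C X \<otimes>\<^sub>1 \<alpha> \<otimes>\<^sub>1 id1 C Y) \<sharp>\<^sub>1 (rho X \<otimes>\<^sub>1 id1 C Y))"
  using whisker_right_hom2[OF tensor_L_hom2, of X Y "rho X \<otimes>\<^sub>1 id1 C Y"] assms
  \<comment> \<open>The slide is applied in a separate pass, because reassociating the tensor would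
    destroy the bracketing on which its left-hand side matches.\<close>
  by (simp add: rho_lam_slide tensor0_assoc) (simp add: tensor1_assoc)

text \<open>The prescribed composite is an invertible cell between two arrows that both begin with
  the equi-arrow X\<alpha>Y, and whiskering by an equi-arrow is bijective on invertible
  cells.\<close>

lemma K_ex1:
  assumes X: "X \<in> obj C" and Y: "Y \<in> obj C"
  shows "\<exists>!k. k \<in> hom2 C (id1 C X \<otimes>\<^sub>1 lam Y) (rho X \<otimes>\<^sub>1 id1 C Y) \<and> invertible C k \<and>
    ((R X \<otimes>\<^sub>2 obj2 C Y) \<sharp>\<^sub>2 id2 C (id1 C X \<otimes>\<^sub>1 lam Y))
      \<bullet> ((obj2 C X \<otimes>\<^sub>2 L Y) \<sharp>\<^sub>2 id2 C (rho X \<otimes>\<^sub>1 id1 C Y))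
    = id2 C (id1 C X \<otimes>\<^sub>1 \<alpha> \<otimes>\<^sub>1 id1 C Y) \<sharp>\<^sub>2 k"
proof -
  define r where "r = (R X \<otimes>\<^sub>2 obj2 C Y) \<sharp>\<^sub>2 id2 C (id1 C X \<otimes>\<^sub>1 lam Y)"
  define l where "l = (obj2 C X \<otimes>\<^sub>2 L Y) \<sharp>\<^sub>2 id2 C (rho X \<otimes>\<^sub>1 id1 C Y)"
  note R = R_tensor_hom2[OF X Y] and L = tensor_L_hom2[OF X Y]
  note r = R_whisker_hom2[OF X Y, folded r_def] and l = L_whisker_hom2[OF X Y, folded l_def]
  have "invertible C r"
    unfolding r_def using X Y
    by (intro invertible_hcomp[OF _ R _ id2_hom2] invertible_tensor[OF R_cell(2,1) _ obj2_hom2]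
        invertible_obj2 invertible_id2)
      (simp_all add: tensor0_assoc)
  moreover have "invertible C l"
    unfolding l_def using X Y
    by (intro invertible_hcomp[OF _ L _ id2_hom2] invertible_tensor[OF _ obj2_hom2 L_cell(2,1)]
        invertible_obj2 invertible_id2)
      (simp_all add: tensor0_assoc)
  ultimately have "invertible C (r \<bullet> l)"
    by (rule invertible_vcomp[OF _ _ r l])
  moreover have "equi_arrow C (id1 C X \<otimes>\<^sub>1 \<alpha> \<otimes>\<^sub>1 id1 C Y)"
    using X Y by (intro equi_arrow_tensor equi_arrow_id1) simp_all
  ultimately have "\<exists>!k. k \<in> hom2 C (id1 C X \<otimes>\<^sub>1 lam Y) (rho X \<otimes>\<^sub>1 id1 C Y) \<and> invertible C k \<and>
      id2 C (id1 C X \<otimes>\<^sub>1 \<alpha> \<otimes>\<^sub>1 id1 C Y) \<sharp>\<^sub>2 k = r \<bullet> l"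
    using X Y vcomp_hom2[OF r l]
    by (intro whisker_left_ex1[where Y = "X \<otimes>\<^sub>0 (I \<otimes>\<^sub>0 Y)" and Z = "X \<otimes>\<^sub>0 Y"])
      (simp_all add: hom1_def tensor0_assoc)
  then show ?thesis
    unfolding r_def l_def by (simp only: eq_commute)
qed

lemma
  assumes "X \<in> obj C" and "Y \<in> obj C"
  shows K_hom2: "K X Y \<in> hom2 C (id1 C X \<otimes>\<^sub>1 lam Y) (rho X \<otimes>\<^sub>1 id1 C Y)"
    and invertible_K: "invertible C (K X Y)"
    and K_eq: "id2 C (id1 C X \<otimes>\<^sub>1 \<alpha> \<otimes>\<^sub>1 id1 C Y) \<sharp>\<^sub>2 K X Y =
      ((R X \<otimes>\<^sub>2 obj2 C Y) \<sharp>\<^sub>2 id2 C (id1 C X \<otimes>\<^sub>1 lam Y))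
      \<bullet> ((obj2 C X \<otimes>\<^sub>2 L Y) \<sharp>\<^sub>2 id2 C (rho X \<otimes>\<^sub>1 id1 C Y))"
  using theI'[OF K_ex1[OF assms]] unfolding K_cell_def by simp_all

text \<open>The uniqueness half as a proof principle: a candidate of the right type that is
  invertible and satisfies the defining equation is \<open>K\<close>. Both identities are obtained
  this way.\<close>

lemma K_eqI:
  assumes "X \<in> obj C" and "Y \<in> obj C"
    and "k \<in> hom2 C (id1 C X \<otimes>\<^sub>1 lam Y) (rho X \<otimes>\<^sub>1 id1 C Y)" and "invertible C k"
    and "id2 C (id1 C X \<otimes>\<^sub>1 \<alpha> \<otimes>\<^sub>1 id1 C Y) \<sharp>\<^sub>2 k =
      ((R X \<otimes>\<^sub>2 obj2 C Y) \<sharp>\<^sub>2 id2 C (id1 C X \<otimes>\<^sub>1 lam Y))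
      \<bullet> ((obj2 C X \<otimes>\<^sub>2 L Y) \<sharp>\<^sub>2 id2 C (rho X \<otimes>\<^sub>1 id1 C Y))"
  shows "k = K X Y"
  using K_ex1[OF assms(1,2)] K_hom2[OF assms(1,2)] invertible_K[OF assms(1,2)]
    K_eq[OF assms(1,2)] assms(3-5)
  by metis

text \<open>The prescribed cell runs from I\<lambda>_XY through \<alpha>XY to I\<lambda>_XY with the
  brackets moved, that is, to \<lambda> at X tensored with I and Y. Both ends are images under
  tensoring with I on the left of arrows from IXY to XY, so cancellability supplies the unique
  preimage.\<close>

lemma
  assumes X: "X \<in> obj C" and Y: "Y \<in> obj C"
  shows Kl_hom2: "Kl X Y \<in> hom2 C (lam (X \<otimes>\<^sub>0 Y)) (lam X \<otimes>\<^sub>1 id1 C Y)"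
    and invertible_Kl: "invertible C (Kl X Y)"
    and Kl_eq: "obj2 C I \<otimes>\<^sub>2 Kl X Y = L (X \<otimes>\<^sub>0 Y) \<bullet> (vinv C (L X) \<otimes>\<^sub>2 obj2 C Y)"
proof -
  define v where "v = vinv C (L X) \<otimes>\<^sub>2 obj2 C Y"
  have v: "v \<in> hom2 C (\<alpha> \<otimes>\<^sub>1 id1 C (X \<otimes>\<^sub>0 Y)) (id1 C I \<otimes>\<^sub>1 (lam X \<otimes>\<^sub>1 id1 C Y))"
    using tensor_hom2[OF vinv_L(1)[OF X] obj2_hom2[OF Y]] X Y
    by (simp add: v_def id1_tensor tensor1_assoc)
  have L: "L (X \<otimes>\<^sub>0 Y) \<in> hom2 C (id1 C I \<otimes>\<^sub>1 lam (X \<otimes>\<^sub>0 Y)) (\<alpha> \<otimes>\<^sub>1 id1 C (X \<otimes>\<^sub>0 Y))"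
    "invertible C (L (X \<otimes>\<^sub>0 Y))"
    using L_cell X Y by simp_all
  have "invertible C v"
    unfolding v_def using X Y
    by (intro invertible_tensor[OF invertible_vinv[OF L_cell(2,1)] vinv_L(1) _ obj2_hom2]
        invertible_obj2)
  then have inv: "invertible C (L (X \<otimes>\<^sub>0 Y) \<bullet> v)"
    using L v by (intro invertible_vcomp)
  have "equivalence_functor (hom_category C (I \<otimes>\<^sub>0 (X \<otimes>\<^sub>0 Y)) (X \<otimes>\<^sub>0 Y))
      (hom_category C (I \<otimes>\<^sub>0 (I \<otimes>\<^sub>0 (X \<otimes>\<^sub>0 Y))) (I \<otimes>\<^sub>0 (X \<otimes>\<^sub>0 Y)))
      (\<lambda>f. id1 C I \<otimes>\<^sub>1 f) (\<lambda>a. obj2 C I \<otimes>\<^sub>2 a)"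
    using unit_object X Y
    by (simp add: unit_object_def cancellable_def fully_faithful_2functor_def)
  then have "\<exists>!k. k \<in> hom2 C (lam (X \<otimes>\<^sub>0 Y)) (lam X \<otimes>\<^sub>1 id1 C Y) \<and> invertible C k \<and>
      obj2 C I \<otimes>\<^sub>2 k = L (X \<otimes>\<^sub>0 Y) \<bullet> v"
    using X Y inv vcomp_hom2[OF L(1) v]
    by (intro equivalence_functor_ex1_hom2) (simp_all add: hom1_def tensor0_assoc)
  from theI'[OF this] show "Kl X Y \<in> hom2 C (lam (X \<otimes>\<^sub>0 Y)) (lam X \<otimes>\<^sub>1 id1 C Y)"
    "invertible C (Kl X Y)"
    "obj2 C I \<otimes>\<^sub>2 Kl X Y = L (X \<otimes>\<^sub>0 Y) \<bullet> (vinv C (L X) \<otimes>\<^sub>2 obj2 C Y)"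
    unfolding K_lam_def v_def by simp_all
qed

text \<open>The mirror image, with tensoring by I on the right. The inverse constraint now comes
  first, because \<open>Kr\<close> ends at \<rho> of the product XY whereas \<open>Kl\<close> starts
  at \<lambda> of it.\<close>

lemma
  assumes X: "X \<in> obj C" and Y: "Y \<in> obj C"
  shows Kr_hom2: "Kr X Y \<in> hom2 C (id1 C X \<otimes>\<^sub>1 rho Y) (rho (X \<otimes>\<^sub>0 Y))"
    and invertible_Kr: "invertible C (Kr X Y)"
    and Kr_eq: "Kr X Y \<otimes>\<^sub>2 obj2 C I = (obj2 C X \<otimes>\<^sub>2 vinv C (R Y)) \<bullet> R (X \<otimes>\<^sub>0 Y)"
proof -
  define v where "v = obj2 C X \<otimes>\<^sub>2 vinv C (R Y)"
  have v: "v \<in> hom2 C (id1 C X \<otimes>\<^sub>1 rho Y \<otimes>\<^sub>1 id1 C I) (id1 C (X \<otimes>\<^sub>0 Y) \<otimes>\<^sub>1 \<alpha>)"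
    using tensor_hom2[OF obj2_hom2[OF X] vinv_R(1)[OF Y]] X Y
    by (simp add: v_def id1_tensor tensor1_assoc)
  have R: "R (X \<otimes>\<^sub>0 Y) \<in> hom2 C (id1 C (X \<otimes>\<^sub>0 Y) \<otimes>\<^sub>1 \<alpha>) (rho (X \<otimes>\<^sub>0 Y) \<otimes>\<^sub>1 id1 C I)"
    "invertible C (R (X \<otimes>\<^sub>0 Y))"
    using R_cell X Y by simp_all
  have "invertible C v"
    unfolding v_def using X Y
    by (intro invertible_tensor[OF _ obj2_hom2 invertible_vinv[OF R_cell(2,1)] vinv_R(1)]
        invertible_obj2)
  then have inv: "invertible C (v \<bullet> R (X \<otimes>\<^sub>0 Y))"
    using R v by (intro invertible_vcomp)
  have "equivalence_functor (hom_category C (X \<otimes>\<^sub>0 Y \<otimes>\<^sub>0 I) (X \<otimes>\<^sub>0 Y))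
      (hom_category C (X \<otimes>\<^sub>0 Y \<otimes>\<^sub>0 I \<otimes>\<^sub>0 I) (X \<otimes>\<^sub>0 Y \<otimes>\<^sub>0 I))
      (\<lambda>f. f \<otimes>\<^sub>1 id1 C I) (\<lambda>a. a \<otimes>\<^sub>2 obj2 C I)"
    using unit_object X Y
    by (simp add: unit_object_def cancellable_def fully_faithful_2functor_def)
  then have "\<exists>!k. k \<in> hom2 C (id1 C X \<otimes>\<^sub>1 rho Y) (rho (X \<otimes>\<^sub>0 Y)) \<and> invertible C k \<and>
      k \<otimes>\<^sub>2 obj2 C I = v \<bullet> R (X \<otimes>\<^sub>0 Y)"
    using X Y inv vcomp_hom2[OF v R(1)]
    by (intro equivalence_functor_ex1_hom2) (simp_all add: hom1_def tensor0_assoc)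
  from theI'[OF this] show "Kr X Y \<in> hom2 C (id1 C X \<otimes>\<^sub>1 rho Y) (rho (X \<otimes>\<^sub>0 Y))"
    "invertible C (Kr X Y)"
    "Kr X Y \<otimes>\<^sub>2 obj2 C I = (obj2 C X \<otimes>\<^sub>2 vinv C (R Y)) \<bullet> R (X \<otimes>\<^sub>0 Y)"
    unfolding K_rho_def v_def by simp_all
qed

section \<open>The two coherence identities\<close>

lemma constraint_cells [simp]:
  assumes "X \<in> obj C"
  shows "obj2 C X \<in> cell C" "L X \<in> cell C" "R X \<in> cell C" "vinv C (L X) \<in> cell C"
    "vinv C (R X) \<in> cell C"
  using assms hom2D(1)[OF obj2_hom2] hom2D(1)[OF L_cell(1)] hom2D(1)[OF R_cell(1)]
    hom2D(1)[OF vinv_L(1)] hom2D(1)[OF vinv_R(1)]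
  by blast+

lemma K_cells [simp]:
  assumes "X \<in> obj C" and "Y \<in> obj C"
  shows "K X Y \<in> cell C" "Kl X Y \<in> cell C" "Kr X Y \<in> cell C"
  using assms hom2D(1)[OF K_hom2] hom2D(1)[OF Kl_hom2] hom2D(1)[OF Kr_hom2] by blast+

lemma id2_cell [simp]: "f \<in> arr C \<Longrightarrow> id2 C f \<in> cell C"
  by (rule hom2D(1)[OF id2_hom2])

text \<open>Normal form for iterated tensors: objects are expanded into their factors and all
  brackets go to the right. Expanding \<open>id2\<close> of a tensor exposes
  \<open>id2 C (id1 C X)\<close>, which the last rule folds back to \<open>obj2 C X\<close>. The
  associativity rules are conditional; membership of the cells involved is supplied by the
  simplification rules above.\<close>

lemmas tensor_normalize = id1_tensor id2_tensor obj2_tensor tensor0_assoc tensor1_assoc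
  tensor2_assoc obj2_def[symmetric]

text \<open>Tensoring with Z distributes over vertical and horizontal composites, so it carries the
  defining equation of \<open>K X Y\<close> along. Strict associativity then exposes X\<alpha>YZ,
  the arrow that also whiskers \<open>K X (Y \<otimes>\<^sub>0 Z)\<close>.\<close>

lemma K_eq_tensor:
  assumes X: "X \<in> obj C" and Y: "Y \<in> obj C" and Z: "Z \<in> obj C"
  shows "id2 C (id1 C X \<otimes>\<^sub>1 \<alpha> \<otimes>\<^sub>1 id1 C (Y \<otimes>\<^sub>0 Z)) \<sharp>\<^sub>2 (K X Y \<otimes>\<^sub>2 obj2 C Z) =
    ((R X \<otimes>\<^sub>2 obj2 C (Y \<otimes>\<^sub>0 Z)) \<sharp>\<^sub>2 id2 C (id1 C X \<otimes>\<^sub>1 (lam Y \<otimes>\<^sub>1 id1 C Z)))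
    \<bullet> ((obj2 C X \<otimes>\<^sub>2 (L Y \<otimes>\<^sub>2 obj2 C Z)) \<sharp>\<^sub>2 id2 C (rho X \<otimes>\<^sub>1 id1 C (Y \<otimes>\<^sub>0 Z)))"
proof -
  have "(id2 C (id1 C X \<otimes>\<^sub>1 \<alpha> \<otimes>\<^sub>1 id1 C Y) \<otimes>\<^sub>2 obj2 C Z) \<sharp>\<^sub>2 (K X Y \<otimes>\<^sub>2 obj2 C Z) =
      (id2 C (id1 C X \<otimes>\<^sub>1 \<alpha> \<otimes>\<^sub>1 id1 C Y) \<sharp>\<^sub>2 K X Y) \<otimes>\<^sub>2 obj2 C Z"
    using assms
    by (intro hcomp_tensor_obj2[symmetric, OF id2_hom2 K_hom2]) (simp_all add: tensor0_assoc)
  also have "\<dots> =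
      (((R X \<otimes>\<^sub>2 obj2 C Y) \<sharp>\<^sub>2 id2 C (id1 C X \<otimes>\<^sub>1 lam Y)) \<otimes>\<^sub>2 obj2 C Z)
      \<bullet> (((obj2 C X \<otimes>\<^sub>2 L Y) \<sharp>\<^sub>2 id2 C (rho X \<otimes>\<^sub>1 id1 C Y)) \<otimes>\<^sub>2 obj2 C Z)"
    using vcomp_tensor_obj2[OF R_whisker_hom2[OF X Y] L_whisker_hom2[OF X Y] Z]
    by (simp add: K_eq[OF X Y])
  also have "((R X \<otimes>\<^sub>2 obj2 C Y) \<sharp>\<^sub>2 id2 C (id1 C X \<otimes>\<^sub>1 lam Y)) \<otimes>\<^sub>2 obj2 C Z =
      (R X \<otimes>\<^sub>2 obj2 C Y \<otimes>\<^sub>2 obj2 C Z) \<sharp>\<^sub>2 (id2 C (id1 C X \<otimes>\<^sub>1 lam Y) \<otimes>\<^sub>2 obj2 C Z)"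
    using assms
    by (intro hcomp_tensor_obj2[OF R_tensor_hom2 id2_hom2]) (simp_all add: tensor0_assoc)
  also have "((obj2 C X \<otimes>\<^sub>2 L Y) \<sharp>\<^sub>2 id2 C (rho X \<otimes>\<^sub>1 id1 C Y)) \<otimes>\<^sub>2 obj2 C Z =
      (obj2 C X \<otimes>\<^sub>2 L Y \<otimes>\<^sub>2 obj2 C Z) \<sharp>\<^sub>2 (id2 C (rho X \<otimes>\<^sub>1 id1 C Y) \<otimes>\<^sub>2 obj2 C Z)"
    using assms
    by (intro hcomp_tensor_obj2[OF tensor_L_hom2 id2_hom2]) (simp_all add: tensor0_assoc)
  finally show ?thesis
    using assms by (simp add: tensor_normalize)
qed

text \<open>The counterpart with X tensored on the left of the defining equation of
  \<open>K Y Z\<close>; the whiskering arrow becomes XY\<alpha>Z.\<close>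

lemma tensor_K_eq:
  assumes X: "X \<in> obj C" and Y: "Y \<in> obj C" and Z: "Z \<in> obj C"
  shows "id2 C (id1 C (X \<otimes>\<^sub>0 Y) \<otimes>\<^sub>1 \<alpha> \<otimes>\<^sub>1 id1 C Z) \<sharp>\<^sub>2 (obj2 C X \<otimes>\<^sub>2 K Y Z) =
    ((obj2 C X \<otimes>\<^sub>2 R Y \<otimes>\<^sub>2 obj2 C Z) \<sharp>\<^sub>2 id2 C (id1 C (X \<otimes>\<^sub>0 Y) \<otimes>\<^sub>1 lam Z))
    \<bullet> ((obj2 C (X \<otimes>\<^sub>0 Y) \<otimes>\<^sub>2 L Z) \<sharp>\<^sub>2 id2 C (id1 C X \<otimes>\<^sub>1 rho Y \<otimes>\<^sub>1 id1 C Z))"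
proof -
  have "(obj2 C X \<otimes>\<^sub>2 id2 C (id1 C Y \<otimes>\<^sub>1 \<alpha> \<otimes>\<^sub>1 id1 C Z)) \<sharp>\<^sub>2 (obj2 C X \<otimes>\<^sub>2 K Y Z) =
      obj2 C X \<otimes>\<^sub>2 (id2 C (id1 C Y \<otimes>\<^sub>1 \<alpha> \<otimes>\<^sub>1 id1 C Z) \<sharp>\<^sub>2 K Y Z)"
    using assms
    by (intro obj2_tensor_hcomp[symmetric, OF id2_hom2 K_hom2]) (simp_all add: tensor0_assoc)
  also have "\<dots> =
      (obj2 C X \<otimes>\<^sub>2 ((R Y \<otimes>\<^sub>2 obj2 C Z) \<sharp>\<^sub>2 id2 C (id1 C Y \<otimes>\<^sub>1 lam Z)))
      \<bullet> (obj2 C X \<otimes>\<^sub>2 ((obj2 C Y \<otimes>\<^sub>2 L Z) \<sharp>\<^sub>2 id2 C (rho Y \<otimes>\<^sub>1 id1 C Z)))"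
    using obj2_tensor_vcomp[OF R_whisker_hom2[OF Y Z] L_whisker_hom2[OF Y Z] X]
    by (simp add: K_eq[OF Y Z])
  also have "obj2 C X \<otimes>\<^sub>2 ((R Y \<otimes>\<^sub>2 obj2 C Z) \<sharp>\<^sub>2 id2 C (id1 C Y \<otimes>\<^sub>1 lam Z)) =
      (obj2 C X \<otimes>\<^sub>2 (R Y \<otimes>\<^sub>2 obj2 C Z)) \<sharp>\<^sub>2 (obj2 C X \<otimes>\<^sub>2 id2 C (id1 C Y \<otimes>\<^sub>1 lam Z))"
    using assms
    by (intro obj2_tensor_hcomp[OF R_tensor_hom2 id2_hom2]) (simp_all add: tensor0_assoc)
  also have "obj2 C X \<otimes>\<^sub>2 ((obj2 C Y \<otimes>\<^sub>2 L Z) \<sharp>\<^sub>2 id2 C (rho Y \<otimes>\<^sub>1 id1 C Z)) =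
      (obj2 C X \<otimes>\<^sub>2 (obj2 C Y \<otimes>\<^sub>2 L Z)) \<sharp>\<^sub>2 (obj2 C X \<otimes>\<^sub>2 id2 C (rho Y \<otimes>\<^sub>1 id1 C Z))"
    using assms
    by (intro obj2_tensor_hcomp[OF tensor_L_hom2 id2_hom2]) (simp_all add: tensor0_assoc)
  finally show ?thesis
    using assms by (simp add: tensor_normalize)
qed

lemma Kl_tensor_K:
  assumes X: "X \<in> obj C" and Y: "Y \<in> obj C" and Z: "Z \<in> obj C"
  shows "(obj2 C X \<otimes>\<^sub>2 Kl Y Z) \<bullet> (K X Y \<otimes>\<^sub>2 obj2 C Z) = K X (Y \<otimes>\<^sub>0 Z)"
proof -
  note YZ = tensor_obj[OF Y Z]
  define f where "f = rho X \<otimes>\<^sub>1 id1 C (Y \<otimes>\<^sub>0 Z)"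
  have f: "f \<in> arr C" "src1 C f = X \<otimes>\<^sub>0 (I \<otimes>\<^sub>0 (Y \<otimes>\<^sub>0 Z))"
    using assms by (simp_all add: f_def tensor0_assoc)
  define u where "u = vinv C (L Y) \<otimes>\<^sub>2 obj2 C Z"
  have u: "u \<in> hom2 C (\<alpha> \<otimes>\<^sub>1 id1 C (Y \<otimes>\<^sub>0 Z)) (id1 C I \<otimes>\<^sub>1 (lam Y \<otimes>\<^sub>1 id1 C Z))"
    using tensor_hom2[OF vinv_L(1)[OF Y] obj2_hom2[OF Z]] assms
    by (simp add: u_def tensor_normalize)
  have v: "L Y \<otimes>\<^sub>2 obj2 C Z \<in>
      hom2 C (id1 C I \<otimes>\<^sub>1 (lam Y \<otimes>\<^sub>1 id1 C Z)) (\<alpha> \<otimes>\<^sub>1 id1 C (Y \<otimes>\<^sub>0 Z))"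
    using tensor_hom2[OF L_cell(1)[OF Y] obj2_hom2[OF Z]] assms
    by (simp add: tensor_normalize)
  have uv: "u \<bullet> (L Y \<otimes>\<^sub>2 obj2 C Z) = id2 C (\<alpha> \<otimes>\<^sub>1 id1 C (Y \<otimes>\<^sub>0 Z))"
    using vcomp_tensor_obj2[OF vinv_L(1)[OF Y] L_cell(1)[OF Y] Z] vinv_L(3)[OF Y] assms
    by (simp add: u_def tensor_normalize)
  have xu: "obj2 C X \<otimes>\<^sub>2 u \<in> hom2 C (id1 C X \<otimes>\<^sub>1 (\<alpha> \<otimes>\<^sub>1 id1 C (Y \<otimes>\<^sub>0 Z)))
      (id1 C X \<otimes>\<^sub>1 (id1 C I \<otimes>\<^sub>1 (lam Y \<otimes>\<^sub>1 id1 C Z)))"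
    and xv: "obj2 C X \<otimes>\<^sub>2 (L Y \<otimes>\<^sub>2 obj2 C Z) \<in>
      hom2 C (id1 C X \<otimes>\<^sub>1 (id1 C I \<otimes>\<^sub>1 (lam Y \<otimes>\<^sub>1 id1 C Z)))
        (id1 C X \<otimes>\<^sub>1 (\<alpha> \<otimes>\<^sub>1 id1 C (Y \<otimes>\<^sub>0 Z)))"
    using tensor_hom2[OF obj2_hom2[OF X] u] tensor_hom2[OF obj2_hom2[OF X] v] .
  have k: "obj2 C X \<otimes>\<^sub>2 Kl Y Z \<in>
      hom2 C (id1 C X \<otimes>\<^sub>1 lam (Y \<otimes>\<^sub>0 Z)) (id1 C X \<otimes>\<^sub>1 (lam Y \<otimes>\<^sub>1 id1 C Z))"
    using assms by (intro tensor_hom2 obj2_hom2 Kl_hom2)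
  have m: "K X Y \<otimes>\<^sub>2 obj2 C Z \<in> hom2 C (id1 C X \<otimes>\<^sub>1 (lam Y \<otimes>\<^sub>1 id1 C Z)) f"
    using tensor_hom2[OF K_hom2[OF X Y] obj2_hom2[OF Z]] assms
    by (simp add: f_def tensor_normalize)
  have slide1: "(rho X \<otimes>\<^sub>1 id1 C I \<otimes>\<^sub>1 id1 C (Y \<otimes>\<^sub>0 Z)) \<sharp>\<^sub>1 (id1 C X \<otimes>\<^sub>1 (lam Y \<otimes>\<^sub>1 id1 C Z)) =
      (id1 C X \<otimes>\<^sub>1 (id1 C I \<otimes>\<^sub>1 (lam Y \<otimes>\<^sub>1 id1 C Z))) \<sharp>\<^sub>1 f"
    using comp1_slide[of "rho X" "X \<otimes>\<^sub>0 I" X "lam Y \<otimes>\<^sub>1 id1 C Z" "I \<otimes>\<^sub>0 (Y \<otimes>\<^sub>0 Z)" "Y \<otimes>\<^sub>0 Z"] assms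
    by (simp add: f_def tensor_normalize)
  \<comment> \<open>\<open>Kl Y Z\<close> lives on the right tensor factor and \<rho>_X on the left
    one. Moving past \<rho>_X, which runs from XI to X, replaces the factor X by XI, and
    \<open>Kl_eq\<close> becomes applicable.\<close>
  have "id2 C (rho X \<otimes>\<^sub>1 id1 C I \<otimes>\<^sub>1 id1 C (Y \<otimes>\<^sub>0 Z)) \<sharp>\<^sub>2 (obj2 C X \<otimes>\<^sub>2 Kl Y Z) =
      (obj2 C X \<otimes>\<^sub>2 (obj2 C I \<otimes>\<^sub>2 Kl Y Z)) \<sharp>\<^sub>2 id2 C f"
    using hcomp_slide[OF id2_hom2[of "rho X"] _ _ Kl_hom2[OF Y Z],
        of "X \<otimes>\<^sub>0 I" X "I \<otimes>\<^sub>0 (Y \<otimes>\<^sub>0 Z)" "Y \<otimes>\<^sub>0 Z"] assms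
    by (simp add: f_def tensor_normalize)
  also have "obj2 C X \<otimes>\<^sub>2 (obj2 C I \<otimes>\<^sub>2 Kl Y Z) =
      (obj2 C X \<otimes>\<^sub>2 L (Y \<otimes>\<^sub>0 Z)) \<bullet> (obj2 C X \<otimes>\<^sub>2 u)"
    using obj2_tensor_vcomp[OF L_cell(1)[OF YZ] u X] by (simp add: Kl_eq[OF Y Z] u_def)
  also have "\<dots> \<sharp>\<^sub>2 id2 C f =
      ((obj2 C X \<otimes>\<^sub>2 L (Y \<otimes>\<^sub>0 Z)) \<sharp>\<^sub>2 id2 C f) \<bullet> ((obj2 C X \<otimes>\<^sub>2 u) \<sharp>\<^sub>2 id2 C f)"
    using assms f by (intro whisker_right_vcomp[OF tensor_L_hom2[OF X YZ] xu]) simp_all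
  finally have p'k: "id2 C (rho X \<otimes>\<^sub>1 id1 C I \<otimes>\<^sub>1 id1 C (Y \<otimes>\<^sub>0 Z)) \<sharp>\<^sub>2 (obj2 C X \<otimes>\<^sub>2 Kl Y Z) =
      ((obj2 C X \<otimes>\<^sub>2 L (Y \<otimes>\<^sub>0 Z)) \<sharp>\<^sub>2 id2 C f) \<bullet> ((obj2 C X \<otimes>\<^sub>2 u) \<sharp>\<^sub>2 id2 C f)" .
  have c: "(obj2 C X \<otimes>\<^sub>2 (L Y \<otimes>\<^sub>2 obj2 C Z)) \<sharp>\<^sub>2 id2 C f \<in>
      hom2 C ((rho X \<otimes>\<^sub>1 id1 C I \<otimes>\<^sub>1 id1 C (Y \<otimes>\<^sub>0 Z)) \<sharp>\<^sub>1 (id1 C X \<otimes>\<^sub>1 (lam Y \<otimes>\<^sub>1 id1 C Z)))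
        ((id1 C X \<otimes>\<^sub>1 \<alpha> \<otimes>\<^sub>1 id1 C (Y \<otimes>\<^sub>0 Z)) \<sharp>\<^sub>1 f)"
    using whisker_right_hom2[OF xv f(1)] assms f
    by (simp add: slide1) (simp add: tensor_normalize)
  have c': "(obj2 C X \<otimes>\<^sub>2 u) \<sharp>\<^sub>2 id2 C f \<in>
      hom2 C ((id1 C X \<otimes>\<^sub>1 \<alpha> \<otimes>\<^sub>1 id1 C (Y \<otimes>\<^sub>0 Z)) \<sharp>\<^sub>1 f)
        ((rho X \<otimes>\<^sub>1 id1 C I \<otimes>\<^sub>1 id1 C (Y \<otimes>\<^sub>0 Z)) \<sharp>\<^sub>1 (id1 C X \<otimes>\<^sub>1 (lam Y \<otimes>\<^sub>1 id1 C Z)))"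
    using whisker_right_hom2[OF xu f(1)] assms f
    by (simp add: slide1) (simp add: tensor_normalize)
  have "(obj2 C X \<otimes>\<^sub>2 u) \<bullet> (obj2 C X \<otimes>\<^sub>2 (L Y \<otimes>\<^sub>2 obj2 C Z)) =
      id2 C (id1 C X \<otimes>\<^sub>1 \<alpha> \<otimes>\<^sub>1 id1 C (Y \<otimes>\<^sub>0 Z))"
    using obj2_tensor_vcomp[OF u v X] uv assms by (simp add: tensor_normalize)
  then have c'c: "((obj2 C X \<otimes>\<^sub>2 u) \<sharp>\<^sub>2 id2 C f) \<bullet>
      ((obj2 C X \<otimes>\<^sub>2 (L Y \<otimes>\<^sub>2 obj2 C Z)) \<sharp>\<^sub>2 id2 C f) =
      id2 C ((id1 C X \<otimes>\<^sub>1 \<alpha> \<otimes>\<^sub>1 id1 C (Y \<otimes>\<^sub>0 Z)) \<sharp>\<^sub>1 f)"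
    using whisker_right_vcomp[OF xu xv f(1)] assms f by (simp add: id2_comp1 tensor0_assoc)
  \<comment> \<open>In the slide, a is R_X tensored with YZ, running from X\<alpha>YZ to \<rho>_X
    tensored with IYZ. The cells b, c and c' are all whiskered by \<open>f\<close>: b comes from L
    at YZ, c from L_Y tensored with Z, and c' from \<open>u\<close>. The common end s of b and c is
    X\<alpha>YZ followed by \<open>f\<close>.\<close>
  have eq: "id2 C (id1 C X \<otimes>\<^sub>1 \<alpha> \<otimes>\<^sub>1 id1 C (Y \<otimes>\<^sub>0 Z)) \<sharp>\<^sub>2
      ((obj2 C X \<otimes>\<^sub>2 Kl Y Z) \<bullet> (K X Y \<otimes>\<^sub>2 obj2 C Z)) =
      ((R X \<otimes>\<^sub>2 obj2 C (Y \<otimes>\<^sub>0 Z)) \<sharp>\<^sub>2 id2 C (id1 C X \<otimes>\<^sub>1 lam (Y \<otimes>\<^sub>0 Z)))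
      \<bullet> ((obj2 C X \<otimes>\<^sub>2 L (Y \<otimes>\<^sub>0 Z)) \<sharp>\<^sub>2 id2 C f)"
    using assms
    by (intro whisker_vcomp_slide_left[OF R_tensor_hom2[OF X YZ] k m _
          K_eq_tensor[OF assms, folded f_def] p'k c
          L_whisker_hom2[OF X YZ, folded f_def] c' c'c])
      (simp add: tensor0_assoc)
  \<comment> \<open>Invertibility is a clause of the description of \<open>K\<close>, so uniqueness
    can be invoked only once it is known for the composite.\<close>
  have "invertible C ((obj2 C X \<otimes>\<^sub>2 Kl Y Z) \<bullet> (K X Y \<otimes>\<^sub>2 obj2 C Z))"
    using assms
    by (intro invertible_vcomp[OF _ _ k m] invertible_tensor[OF _ obj2_hom2 _ Kl_hom2]
        invertible_tensor[OF _ K_hom2 _ obj2_hom2] invertible_obj2 invertible_K invertible_Kl)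
  then show ?thesis
    using vcomp_hom2[OF k m] eq by (intro K_eqI[OF X YZ]) (simp_all add: f_def)
qed

lemma tensor_K_Kr:
  assumes X: "X \<in> obj C" and Y: "Y \<in> obj C" and Z: "Z \<in> obj C"
  shows "(obj2 C X \<otimes>\<^sub>2 K Y Z) \<bullet> (Kr X Y \<otimes>\<^sub>2 obj2 C Z) = K (X \<otimes>\<^sub>0 Y) Z"
proof -
  note XY = tensor_obj[OF X Y]
  define f where "f = id1 C (X \<otimes>\<^sub>0 Y) \<otimes>\<^sub>1 lam Z"
  have f: "f \<in> arr C" "src1 C f = X \<otimes>\<^sub>0 (Y \<otimes>\<^sub>0 (I \<otimes>\<^sub>0 Z))"
    using assms by (simp_all add: f_def tensor0_assoc)
  define u where "u = obj2 C X \<otimes>\<^sub>2 vinv C (R Y)"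
  have u: "u \<in> hom2 C (id1 C X \<otimes>\<^sub>1 rho Y \<otimes>\<^sub>1 id1 C I) (id1 C (X \<otimes>\<^sub>0 Y) \<otimes>\<^sub>1 \<alpha>)"
    using tensor_hom2[OF obj2_hom2[OF X] vinv_R(1)[OF Y]] assms
    by (simp add: u_def tensor_normalize)
  have v: "obj2 C X \<otimes>\<^sub>2 R Y \<in> hom2 C (id1 C (X \<otimes>\<^sub>0 Y) \<otimes>\<^sub>1 \<alpha>) (id1 C X \<otimes>\<^sub>1 rho Y \<otimes>\<^sub>1 id1 C I)"
    using tensor_hom2[OF obj2_hom2[OF X] R_cell(1)[OF Y]] assms
    by (simp add: tensor_normalize)
  have vu: "(obj2 C X \<otimes>\<^sub>2 R Y) \<bullet> u = id2 C (id1 C (X \<otimes>\<^sub>0 Y) \<otimes>\<^sub>1 \<alpha>)"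
    using obj2_tensor_vcomp[OF R_cell(1)[OF Y] vinv_R(1)[OF Y] X] vinv_R(2)[OF Y] assms
    by (simp add: u_def tensor_normalize)
  have uz: "u \<otimes>\<^sub>2 obj2 C Z \<in> hom2 C (id1 C X \<otimes>\<^sub>1 rho Y \<otimes>\<^sub>1 id1 C I \<otimes>\<^sub>1 id1 C Z)
      (id1 C (X \<otimes>\<^sub>0 Y) \<otimes>\<^sub>1 \<alpha> \<otimes>\<^sub>1 id1 C Z)"
    and vz: "obj2 C X \<otimes>\<^sub>2 R Y \<otimes>\<^sub>2 obj2 C Z \<in> hom2 C (id1 C (X \<otimes>\<^sub>0 Y) \<otimes>\<^sub>1 \<alpha> \<otimes>\<^sub>1 id1 C Z)
      (id1 C X \<otimes>\<^sub>1 rho Y \<otimes>\<^sub>1 id1 C I \<otimes>\<^sub>1 id1 C Z)"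
    using tensor_hom2[OF u obj2_hom2[OF Z]] tensor_hom2[OF v obj2_hom2[OF Z]] .
  have k: "Kr X Y \<otimes>\<^sub>2 obj2 C Z \<in>
      hom2 C (id1 C X \<otimes>\<^sub>1 rho Y \<otimes>\<^sub>1 id1 C Z) (rho (X \<otimes>\<^sub>0 Y) \<otimes>\<^sub>1 id1 C Z)"
    using assms by (intro tensor_hom2 obj2_hom2 Kr_hom2)
  have m: "obj2 C X \<otimes>\<^sub>2 K Y Z \<in> hom2 C f (id1 C X \<otimes>\<^sub>1 rho Y \<otimes>\<^sub>1 id1 C Z)"
    using tensor_hom2[OF obj2_hom2[OF X] K_hom2[OF Y Z]] assms
    by (simp add: f_def tensor_normalize)
  have b: "obj2 C (X \<otimes>\<^sub>0 Y) \<otimes>\<^sub>2 L Z \<in>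
      hom2 C (id1 C (X \<otimes>\<^sub>0 Y) \<otimes>\<^sub>1 (id1 C I \<otimes>\<^sub>1 lam Z)) (id1 C (X \<otimes>\<^sub>0 Y) \<otimes>\<^sub>1 \<alpha> \<otimes>\<^sub>1 id1 C Z)"
    using tensor_L_hom2[OF XY Z] assms by (simp add: tensor1_assoc)
  \<comment> \<open>The R-cells are whiskered by \<open>f\<close>, so they naturally border on
    composites ending in \<open>f\<close>, while the slide below needs the order that begins with
    XYI\<lambda>_Z. This equation serves c and c'; the next one serves the cell built from R at
    XY.\<close>
  have slide1: "(id1 C X \<otimes>\<^sub>1 rho Y \<otimes>\<^sub>1 id1 C I \<otimes>\<^sub>1 id1 C Z) \<sharp>\<^sub>1 f =
      (id1 C (X \<otimes>\<^sub>0 Y) \<otimes>\<^sub>1 (id1 C I \<otimes>\<^sub>1 lam Z)) \<sharp>\<^sub>1 (id1 C X \<otimes>\<^sub>1 rho Y \<otimes>\<^sub>1 id1 C Z)"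
    using comp1_slide[of "id1 C X \<otimes>\<^sub>1 rho Y" "X \<otimes>\<^sub>0 (Y \<otimes>\<^sub>0 I)" "X \<otimes>\<^sub>0 Y" "lam Z" "I \<otimes>\<^sub>0 Z" Z] assms
    by (simp add: f_def tensor_normalize)
  have slide2: "(rho (X \<otimes>\<^sub>0 Y) \<otimes>\<^sub>1 id1 C I \<otimes>\<^sub>1 id1 C Z) \<sharp>\<^sub>1 f =
      (id1 C (X \<otimes>\<^sub>0 Y) \<otimes>\<^sub>1 (id1 C I \<otimes>\<^sub>1 lam Z)) \<sharp>\<^sub>1 (rho (X \<otimes>\<^sub>0 Y) \<otimes>\<^sub>1 id1 C Z)"
    using rho_lam_slide[OF XY Z] by (simp add: f_def)
  \<comment> \<open>Now the moving cell \<open>Kr X Y\<close> is on the left factor and \<lambda>_Z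
    on the right one. Passing \<lambda>_Z, which runs from IZ to Z, replaces the factor Z by IZ, so
    that \<open>Kr_eq\<close> applies.\<close>
  have "id2 C (id1 C (X \<otimes>\<^sub>0 Y) \<otimes>\<^sub>1 (id1 C I \<otimes>\<^sub>1 lam Z)) \<sharp>\<^sub>2 (Kr X Y \<otimes>\<^sub>2 obj2 C Z) =
      (Kr X Y \<otimes>\<^sub>2 obj2 C I \<otimes>\<^sub>2 obj2 C Z) \<sharp>\<^sub>2 id2 C f"
    using hcomp_slide[OF Kr_hom2[OF X Y] _ _ id2_hom2[of "lam Z"],
        of "X \<otimes>\<^sub>0 (Y \<otimes>\<^sub>0 I)" "X \<otimes>\<^sub>0 Y" "I \<otimes>\<^sub>0 Z" Z] assms
    by (simp add: f_def tensor_normalize)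
  also have "Kr X Y \<otimes>\<^sub>2 obj2 C I \<otimes>\<^sub>2 obj2 C Z =
      (u \<otimes>\<^sub>2 obj2 C Z) \<bullet> (R (X \<otimes>\<^sub>0 Y) \<otimes>\<^sub>2 obj2 C Z)"
    using vcomp_tensor_obj2[OF u R_cell(1)[OF XY] Z] by (simp add: Kr_eq[OF X Y] u_def)
  also have "\<dots> \<sharp>\<^sub>2 id2 C f =
      ((u \<otimes>\<^sub>2 obj2 C Z) \<sharp>\<^sub>2 id2 C f) \<bullet> ((R (X \<otimes>\<^sub>0 Y) \<otimes>\<^sub>2 obj2 C Z) \<sharp>\<^sub>2 id2 C f)"
    using assms f
    by (intro whisker_right_vcomp[OF uz R_tensor_hom2[OF XY Z]]) (simp_all add: tensor0_assoc)
  finally have p'k: "id2 C (id1 C (X \<otimes>\<^sub>0 Y) \<otimes>\<^sub>1 (id1 C I \<otimes>\<^sub>1 lam Z)) \<sharp>\<^sub>2 (Kr X Y \<otimes>\<^sub>2 obj2 C Z) =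
      ((u \<otimes>\<^sub>2 obj2 C Z) \<sharp>\<^sub>2 id2 C f) \<bullet> ((R (X \<otimes>\<^sub>0 Y) \<otimes>\<^sub>2 obj2 C Z) \<sharp>\<^sub>2 id2 C f)" .
  have c: "(obj2 C X \<otimes>\<^sub>2 R Y \<otimes>\<^sub>2 obj2 C Z) \<sharp>\<^sub>2 id2 C f \<in>
      hom2 C ((id1 C (X \<otimes>\<^sub>0 Y) \<otimes>\<^sub>1 \<alpha> \<otimes>\<^sub>1 id1 C Z) \<sharp>\<^sub>1 f)
        ((id1 C (X \<otimes>\<^sub>0 Y) \<otimes>\<^sub>1 (id1 C I \<otimes>\<^sub>1 lam Z)) \<sharp>\<^sub>1 (id1 C X \<otimes>\<^sub>1 rho Y \<otimes>\<^sub>1 id1 C Z))"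
    using whisker_right_hom2[OF vz f(1)] assms f by (simp add: slide1 tensor0_assoc)
  have c': "(u \<otimes>\<^sub>2 obj2 C Z) \<sharp>\<^sub>2 id2 C f \<in>
      hom2 C ((id1 C (X \<otimes>\<^sub>0 Y) \<otimes>\<^sub>1 (id1 C I \<otimes>\<^sub>1 lam Z)) \<sharp>\<^sub>1 (id1 C X \<otimes>\<^sub>1 rho Y \<otimes>\<^sub>1 id1 C Z))
        ((id1 C (X \<otimes>\<^sub>0 Y) \<otimes>\<^sub>1 \<alpha> \<otimes>\<^sub>1 id1 C Z) \<sharp>\<^sub>1 f)"
    using whisker_right_hom2[OF uz f(1)] assms f by (simp add: slide1 tensor0_assoc)
  have "(obj2 C X \<otimes>\<^sub>2 R Y \<otimes>\<^sub>2 obj2 C Z) \<bullet> (u \<otimes>\<^sub>2 obj2 C Z) =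
      id2 C (id1 C (X \<otimes>\<^sub>0 Y) \<otimes>\<^sub>1 \<alpha> \<otimes>\<^sub>1 id1 C Z)"
    using vcomp_tensor_obj2[OF v u Z] vu assms by (simp add: tensor_normalize)
  then have cc': "((obj2 C X \<otimes>\<^sub>2 R Y \<otimes>\<^sub>2 obj2 C Z) \<sharp>\<^sub>2 id2 C f) \<bullet>
      ((u \<otimes>\<^sub>2 obj2 C Z) \<sharp>\<^sub>2 id2 C f) =
      id2 C ((id1 C (X \<otimes>\<^sub>0 Y) \<otimes>\<^sub>1 \<alpha> \<otimes>\<^sub>1 id1 C Z) \<sharp>\<^sub>1 f)"
    using whisker_right_vcomp[OF vz uz f(1)] assms f by (simp add: id2_comp1 tensor0_assoc)
  \<comment> \<open>Here b is L_Z tensored with XY, running from XYI\<lambda>_Z to XY\<alpha>Z. The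
    cells a, c and c' are whiskered by \<open>f\<close>: a comes from R at XY, c from R_Y, and c'
    from its inverse in \<open>u\<close>. The common start s of a and c is XY\<alpha>Z followed by
    \<open>f\<close>.\<close>
  have eq: "id2 C (id1 C (X \<otimes>\<^sub>0 Y) \<otimes>\<^sub>1 \<alpha> \<otimes>\<^sub>1 id1 C Z) \<sharp>\<^sub>2
      ((obj2 C X \<otimes>\<^sub>2 K Y Z) \<bullet> (Kr X Y \<otimes>\<^sub>2 obj2 C Z)) =
      ((R (X \<otimes>\<^sub>0 Y) \<otimes>\<^sub>2 obj2 C Z) \<sharp>\<^sub>2 id2 C f)
      \<bullet> ((obj2 C (X \<otimes>\<^sub>0 Y) \<otimes>\<^sub>2 L Z) \<sharp>\<^sub>2 id2 C (rho (X \<otimes>\<^sub>0 Y) \<otimes>\<^sub>1 id1 C Z))"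
    using assms
    by (intro whisker_vcomp_slide_right[OF b k m _ tensor_K_eq[OF assms, folded f_def] p'k c
          R_whisker_hom2[OF XY Z, folded f_def, unfolded slide2] c' cc'])
      (simp add: tensor0_assoc)
  have "invertible C ((obj2 C X \<otimes>\<^sub>2 K Y Z) \<bullet> (Kr X Y \<otimes>\<^sub>2 obj2 C Z))"
    using assms
    by (intro invertible_vcomp[OF _ _ m k] invertible_tensor[OF _ obj2_hom2 _ K_hom2]
        invertible_tensor[OF _ Kr_hom2 _ obj2_hom2] invertible_obj2 invertible_K invertible_Kr)
  then show ?thesis
    using vcomp_hom2[OF m k] eq by (intro K_eqI[OF XY Z]) (simp_all add: f_def)
qed

end

theorem proposition7p4:
  fixes C :: "('o, 'a, 'c) semi_monoidal_2cat" (structure)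
    and I :: 'o and \<alpha> :: 'a
    and lam rho :: "'o \<Rightarrow> 'a" and L R :: "'o \<Rightarrow> 'c"
    and K Kl Kr :: "'o \<Rightarrow> 'o \<Rightarrow> 'c"
  assumes "semi_monoidal_2category C"
    and "unit_object C I \<alpha>"
    and "left_constraint C I \<alpha> lam L"
    and "right_constraint C I \<alpha> rho R"
  defines "K \<equiv> K_cell C \<alpha> lam L rho R"
    and "Kl \<equiv> K_lam C I lam L"
    and "Kr \<equiv> K_rho C I rho R"
  shows "\<forall>X\<in>obj C. \<forall>Y\<in>obj C. \<forall>Z\<in>obj C.
     (K X (Y \<otimes>\<^sub>0 Z) \<in> hom2 C (id1 C X \<otimes>\<^sub>1 lam (Y \<otimes>\<^sub>0 Z)) (rho X \<otimes>\<^sub>1 id1 C (Y \<otimes>\<^sub>0 Z)) \<and>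
      (obj2 C X \<otimes>\<^sub>2 Kl Y Z) \<bullet> (K X Y \<otimes>\<^sub>2 obj2 C Z) = K X (Y \<otimes>\<^sub>0 Z)) \<and>
     (K (X \<otimes>\<^sub>0 Y) Z \<in> hom2 C (id1 C (X \<otimes>\<^sub>0 Y) \<otimes>\<^sub>1 lam Z) (rho (X \<otimes>\<^sub>0 Y) \<otimes>\<^sub>1 id1 C Z) \<and>
      (obj2 C X \<otimes>\<^sub>2 K Y Z) \<bullet> (Kr X Y \<otimes>\<^sub>2 obj2 C Z) = K (X \<otimes>\<^sub>0 Y) Z)"
proof -
  interpret unit_constraints C I \<alpha> lam rho L R
    using assms(1-4) by (intro unit_constraints.intro unit_constraints_axioms.intro)
  show ?thesis
    \<comment> \<open>The membership conjuncts are the typing of \<open>K\<close> at the pairs (X,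
      YZ) and (XY, Z).\<close>
    unfolding assms(5-7) using Kl_tensor_K tensor_K_Kr K_hom2 by simp
qed

end
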